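(* Let $G$ be a locally free group with $|G|>\aleph_0$. Then for each finitely generated subgroup $A$ of $G$, there exists a subgroup $H$ of $G$ with $|H|=|G|$ such that the subgroup $AH$ of $G$ generated by $A$ and $H$ is isomorphic to the free product $A*H$. In particular, $G$ has a free subgroup of the same cardinality as that of $G$.
   Context: A group is locally free if all of its finitely generated subgroups are free. $|X|$ denotes the cardinality of $X$. *)

theory Defs
  imports "HOL-Algebra.Algebra" "HOL-Library.Equipollence"
begin

text \<open>A word over a set of generators: a list of letters (s, x) meaning x if s is True
and the inverse of x if s is False.\<close>

fun word_reduced :: "(bool \<times> 'a) list \<Rightarrow> bool" where
  "word_reduced [] = True"
| "word_reduced [_] = True"
| "word_reduced ((s, x) # (t, y) # w) = (\<not> (x = y \<and> s \<noteq> t) \<and> word_reduced ((t, y) # w))"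

definition word_eval :: "('a, 'b) monoid_scheme \<Rightarrow> (bool \<times> 'a) list \<Rightarrow> 'a" where
  "word_eval G w = foldr (\<lambda>(s, x) r. (if s then x else inv\<^bsub>G\<^esub> x) \<otimes>\<^bsub>G\<^esub> r) w \<one>\<^bsub>G\<^esub>"

definition free_basis :: "('a, 'b) monoid_scheme \<Rightarrow> 'a set \<Rightarrow> bool" where
  "free_basis G B \<longleftrightarrow> B \<subseteq> carrier G \<and> generate G B = carrier G \<and>
     (\<forall>w. w \<noteq> [] \<and> word_reduced w \<and> snd ` set w \<subseteq> B \<longrightarrow> word_eval G w \<noteq> one G)"

definition free_group :: "('a, 'b) monoid_scheme \<Rightarrow> bool" where
  "free_group G \<longleftrightarrow> group G \<and> (\<exists>B. free_basis G B)"

definition fin_gen_subgroup :: "('a, 'b) monoid_scheme \<Rightarrow> 'a set \<Rightarrow> bool" where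
  "fin_gen_subgroup G A \<longleftrightarrow> (\<exists>S. finite S \<and> S \<subseteq> carrier G \<and> generate G S = A)"

definition locally_free :: "('a, 'b) monoid_scheme \<Rightarrow> bool" where
  "locally_free G \<longleftrightarrow> group G \<and>
     (\<forall>A. fin_gen_subgroup G A \<longrightarrow> free_group (subgroup_generated G A))"

fun fp_reduced :: "('a, 'c) monoid_scheme \<Rightarrow> ('b, 'd) monoid_scheme \<Rightarrow> ('a + 'b) list \<Rightarrow> bool" where
  "fp_reduced G1 G2 [] = True"
| "fp_reduced G1 G2 (Inl a # w) = (a \<in> carrier G1 \<and> a \<noteq> \<one>\<^bsub>G1\<^esub> \<and> fp_reduced G1 G2 w \<and>
      (case w of Inl _ # _ \<Rightarrow> False | _ \<Rightarrow> True))"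
| "fp_reduced G1 G2 (Inr b # w) = (b \<in> carrier G2 \<and> b \<noteq> \<one>\<^bsub>G2\<^esub> \<and> fp_reduced G1 G2 w \<and>
      (case w of Inr _ # _ \<Rightarrow> False | _ \<Rightarrow> True))"

fun fp_cons :: "('a, 'c) monoid_scheme \<Rightarrow> ('b, 'd) monoid_scheme \<Rightarrow> 'a + 'b \<Rightarrow> ('a + 'b) list \<Rightarrow> ('a + 'b) list" where
  "fp_cons G1 G2 (Inl a) [] = (if a = \<one>\<^bsub>G1\<^esub> then [] else [Inl a])"
| "fp_cons G1 G2 (Inl a) (Inl c # w) =
     (if a \<otimes>\<^bsub>G1\<^esub> c = \<one>\<^bsub>G1\<^esub> then w else Inl (a \<otimes>\<^bsub>G1\<^esub> c) # w)"
| "fp_cons G1 G2 (Inl a) (Inr d # w) =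
     (if a = \<one>\<^bsub>G1\<^esub> then Inr d # w else Inl a # Inr d # w)"
| "fp_cons G1 G2 (Inr b) [] = (if b = \<one>\<^bsub>G2\<^esub> then [] else [Inr b])"
| "fp_cons G1 G2 (Inr b) (Inr d # w) =
     (if b \<otimes>\<^bsub>G2\<^esub> d = \<one>\<^bsub>G2\<^esub> then w else Inr (b \<otimes>\<^bsub>G2\<^esub> d) # w)"
| "fp_cons G1 G2 (Inr b) (Inl c # w) =
     (if b = \<one>\<^bsub>G2\<^esub> then Inl c # w else Inr b # Inl c # w)"

definition free_product :: "('a, 'c) monoid_scheme \<Rightarrow> ('b, 'd) monoid_scheme \<Rightarrow> ('a + 'b) list monoid" where
  "free_product G1 G2 =
     \<lparr> carrier = {w. fp_reduced G1 G2 w},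
       monoid.mult = (\<lambda>u v. foldr (fp_cons G1 G2) u v),
       one = [] \<rparr>"

end

theory Submission
  imports Defs "HOL-Analysis.Continuum_Not_Denumerable" "HOL-Library.Countable_Set"
    "HOL-Computational_Algebra.Polynomial"
begin

text \<open>Extend a finite basis of A to a maximal free family M of G. Every g in G is then dependent on
  a finite subset Z of M, so it suffices that the set D of elements dependent on a finite free family Z
  of size n is countable. Finitely generated free groups are Hopfian (count homomorphisms into finite
  quotients of SL2 over the integers), hence adjoining elements of D to Z never raises the rank: every
  finite part T of D lies in a free subgroup of rank at most n. Such a subgroup has a faithful
  generic representation in SL2 over the reals, given by 4n algebraically independent parameters.
  Polynomial relations between matrix entries persist when T grows, because every representation is a
  specialization of the generic one. So all matrix entries are algebraic over at most 4n
  of them, with countably many possible equations, each having finitely many roots.\<close>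

section \<open>Words and free families\<close>

text \<open>The obstacle is that the set D of elements dependent on Z need not lie in any finitely
  generated subgroup: already for one element Z, it can look like the additive group of the
  rationals. The bases of the subgroups generated by Z and finite parts of D are unrelated to one
  another, so there is no fixed finite set of generators whose words could be counted. Algebraic
  dimension replaces it, being bounded at every finite stage and compatible with enlarging the
  stage. SL2 serves three purposes. Determinant one makes inverses polynomial; four elementary
  factors make the real group a polynomial image of affine 4-space, so that a free group of rank n
  costs 4n parameters and all its representations are specializations; and the integer matrices
  contain free groups of every finite rank. The cardinal arithmetic is then short: G is a union of
  countable sets indexed by the finite subsets of M, which forces M to be infinite and of the size
  of G. Discarding from M the finite basis of A leaves a basis of H.\<close>

definition winv :: "(bool \<times> 'a) list \<Rightarrow> (bool \<times> 'a) list" where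
  "winv w = rev (map (apfst Not) w)"

text \<open>Left multiplication of a reduced word by one letter: only the head can cancel, and what
  remains is again reduced. Folding this operation over a word performs free reduction.\<close>

fun wcons :: "bool \<times> 'a \<Rightarrow> (bool \<times> 'a) list \<Rightarrow> (bool \<times> 'a) list" where
  "wcons l [] = [l]"
| "wcons (s, x) ((t, y) # w) = (if x = y \<and> s \<noteq> t then w else (s, x) # (t, y) # w)"

definition wred :: "(bool \<times> 'a) list \<Rightarrow> (bool \<times> 'a) list" where
  "wred w = foldr wcons w []"

text \<open>This is \<open>free_basis\<close> without the requirement of generating the group, so
  that freeness of many subgroups can be discussed with words evaluated in one fixed group.\<close>

definition free_family :: "('a, 'b) monoid_scheme \<Rightarrow> 'a set \<Rightarrow> bool" where
  "free_family G B \<longleftrightarrow> B \<subseteq> carrier G \<and>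
     (\<forall>w. w \<noteq> [] \<and> word_reduced w \<and> snd ` set w \<subseteq> B \<longrightarrow> word_eval G w \<noteq> \<one>\<^bsub>G\<^esub>)"

lemma word_reduced_Cons:
  "word_reduced (l # w) \<longleftrightarrow>
     word_reduced w \<and> (w = [] \<or> \<not> (snd l = snd (hd w) \<and> fst l \<noteq> fst (hd w)))"
  by (cases l; cases w) auto

lemma word_reduced_append:
  "word_reduced (u @ v) \<longleftrightarrow> word_reduced u \<and> word_reduced v \<and>
     (u = [] \<or> v = [] \<or> \<not> (snd (last u) = snd (hd v) \<and> fst (last u) \<noteq> fst (hd v)))"
  by (induction u) (auto simp: word_reduced_Cons hd_append)

lemma word_reduced_winv: "word_reduced w \<Longrightarrow> word_reduced (winv w)"
proof (induction w)
  case (Cons l w)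
  then show ?case
    by (auto simp: winv_def word_reduced_append word_reduced_Cons last_rev hd_map)
qed (simp add: winv_def)

lemma snd_set_winv [simp]: "snd ` set (winv w) = snd ` set w"
  by (auto simp: winv_def image_image)

lemma word_reduced_wcons: "word_reduced w \<Longrightarrow> word_reduced (wcons l w)"
  by (cases "(l, w)" rule: wcons.cases) (auto simp: word_reduced_Cons)

lemma word_reduced_wred: "word_reduced (wred w)"
  by (induction w) (auto simp: wred_def word_reduced_wcons)

lemma snd_set_wcons: "snd ` set (wcons l w) \<subseteq> insert (snd l) (snd ` set w)"
  by (cases "(l, w)" rule: wcons.cases) auto

lemma snd_set_wred: "snd ` set (wred w) \<subseteq> snd ` set w"
proof (induction w)
  case (Cons l w)
  then show ?case using snd_set_wcons[of l "wred w"] by (simp add: wred_def) blast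
qed (simp add: wred_def)

section \<open>Evaluation of words in a group\<close>

lemma word_eval_Nil [simp]: "word_eval G [] = \<one>\<^bsub>G\<^esub>"
  by (simp add: word_eval_def)

lemma word_eval_Cons:
  "word_eval G (l # w) = (if fst l then snd l else inv\<^bsub>G\<^esub> (snd l)) \<otimes>\<^bsub>G\<^esub> word_eval G w"
  by (simp add: word_eval_def case_prod_beta)

context group
begin

lemma word_eval_closed: "snd ` set w \<subseteq> carrier G \<Longrightarrow> word_eval G w \<in> carrier G"
  by (induction w) (auto simp: word_eval_Cons)

lemma word_eval_append:
  assumes "snd ` set u \<subseteq> carrier G" "snd ` set v \<subseteq> carrier G"
  shows "word_eval G (u @ v) = word_eval G u \<otimes> word_eval G v"
  using assms by (induction u) (auto simp: word_eval_Cons word_eval_closed m_assoc)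

lemma word_eval_winv:
  assumes "snd ` set w \<subseteq> carrier G"
  shows "word_eval G (winv w) = inv (word_eval G w)"
  using assms
proof (induction w)
  case (Cons l w)
  have "word_eval G (winv (l # w)) = word_eval G (winv w) \<otimes> word_eval G [apfst Not l]"
    using Cons.prems by (subst word_eval_append[symmetric]) (auto simp: winv_def)
  also have "\<dots> = inv (word_eval G (l # w))"
    using Cons by (auto simp: word_eval_Cons inv_mult_group word_eval_closed)
  finally show ?case .
qed (simp add: winv_def)

text \<open>Cancellation is tested on the generators before \<open>f\<close> is applied: letters
  that cancel share a generator, so their images cancel too, even when \<open>f\<close> is not
  injective. This version with a substitution is what makes homomorphisms out of free subgroups well
  defined.\<close>

lemma word_eval_wcons:
  assumes "f ` (snd ` set (l # w)) \<subseteq> carrier G"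
  shows "word_eval G (map (apsnd f) (wcons l w)) = word_eval G (map (apsnd f) (l # w))"
proof (cases "(l, w)" rule: wcons.cases)
  case (2 s x t y v)
  have "word_eval G (map (apsnd f) v) \<in> carrier G"
    using assms 2 by (intro word_eval_closed) (force simp: image_subset_iff)
  then show ?thesis
    using assms 2 by (auto simp: word_eval_Cons m_assoc[symmetric])
qed auto

lemma word_eval_map_wred:
  assumes "f ` (snd ` set w) \<subseteq> carrier G"
  shows "word_eval G (map (apsnd f) (wred w)) = word_eval G (map (apsnd f) w)"
  using assms
proof (induction w)
  case (Cons l w)
  have "f ` (snd ` set (l # wred w)) \<subseteq> carrier G"
    using Cons.prems snd_set_wred[of w] by auto
  then show ?case
    using Cons word_eval_wcons[of f l "wred w"] by (auto simp: wred_def word_eval_Cons)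
qed (simp add: wred_def)

lemma word_eval_wred:
  assumes "snd ` set w \<subseteq> carrier G"
  shows "word_eval G (wred w) = word_eval G w"
  using word_eval_map_wred[of id w] assms by (simp add: apsnd_def prod.map_id0)

lemma word_eval_in_generate: "snd ` set w \<subseteq> B \<Longrightarrow> word_eval G w \<in> generate G B"
  by (induction w) (auto simp: word_eval_Cons intro: generate.intros)

lemma generate_word:
  assumes "B \<subseteq> carrier G" "g \<in> generate G B"
  obtains w where "word_reduced w" "snd ` set w \<subseteq> B" "word_eval G w = g"
proof -
  have "\<exists>w. snd ` set w \<subseteq> B \<and> word_eval G w = g"
    using assms(2)
  proof (induction rule: generate.induct)
    case one
    show ?case by (intro exI[of _ "[]"]) auto
  next
    case (incl h)
    then show ?case using assms(1) by (intro exI[of _ "[(True, h)]"]) (auto simp: word_eval_Cons)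
  next
    case (inv h)
    then show ?case using assms(1) by (intro exI[of _ "[(False, h)]"]) (auto simp: word_eval_Cons)
  next
    case (eng h1 h2)
    then obtain u v where "snd ` set u \<subseteq> B" "word_eval G u = h1" "snd ` set v \<subseteq> B" "word_eval G v = h2"
      by blast
    then show ?case
      using assms(1) by (intro exI[of _ "u @ v"]) (auto simp: word_eval_append image_Un subset_trans)
  qed
  then obtain w where w: "snd ` set w \<subseteq> B" "word_eval G w = g" by blast
  show thesis
  proof (rule that)
    show "word_reduced (wred w)" by (rule word_reduced_wred)
    show "snd ` set (wred w) \<subseteq> B" using w snd_set_wred by fast
    show "word_eval G (wred w) = g" using w assms(1) word_eval_wred[of w] by auto
  qed
qed

lemma free_familyD:
  "free_family G B \<Longrightarrow> word_reduced w \<Longrightarrow> snd ` set w \<subseteq> B \<Longrightarrow> word_eval G w = \<one> \<Longrightarrow> w = []"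
  by (auto simp: free_family_def)

lemma free_family_subset: "free_family G B \<Longrightarrow> C \<subseteq> B \<Longrightarrow> free_family G C"
  unfolding free_family_def by blast

text \<open>Equal first letters are stripped. At the first difference, the inverse of one word
  followed by the other is still reduced, since the two letters at the junction do not cancel; it is
  nonempty with trivial value, against freeness.\<close>

lemma reduced_word_unique:
  assumes "free_family G B" "word_reduced u" "word_reduced v"
    "snd ` set u \<subseteq> B" "snd ` set v \<subseteq> B" "word_eval G u = word_eval G v"
  shows "u = v"
  using assms(2-)
proof (induction u arbitrary: v)
  case Nil
  then show ?case using assms(1) free_familyD[of B v] by auto
next
  case (Cons l u)
  have B: "B \<subseteq> carrier G" using assms(1) by (auto simp: free_family_def)
  show ?case
  proof (cases v)
    case Nil
    then show ?thesis using Cons.prems assms(1) free_familyD[of B "l # u"] by auto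
  next
    case v: (Cons k w)
    show ?thesis
    proof (cases "l = k")
      case True
      have "word_eval G u \<in> carrier G" "word_eval G w \<in> carrier G" "snd l \<in> carrier G"
        using Cons.prems v B by (auto intro!: word_eval_closed)
      then have "word_eval G u = word_eval G w"
        using Cons.prems(5) v True by (auto simp: word_eval_Cons split: if_splits)
      then have "u = w"
        using Cons.prems v by (intro Cons.IH) (auto simp: word_reduced_Cons)
      with v True show ?thesis by simp
    next
      case False
      have s: "snd ` set (winv v) \<subseteq> carrier G" "snd ` set (l # u) \<subseteq> carrier G"
        "snd ` set v \<subseteq> carrier G"
        using Cons.prems B by auto
      have "last (winv v) = apfst Not k" "winv v \<noteq> []" using v by (simp_all add: winv_def)
      then have "word_reduced (winv v @ l # u)"
        using Cons.prems False word_reduced_winv[of v] v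
        by (auto simp: word_reduced_append prod_eq_iff)
      moreover have "word_eval G (winv v @ l # u) = \<one>"
        using s Cons.prems(5) word_eval_closed[of v] 
        by (subst word_eval_append) (auto simp: word_eval_winv)
      ultimately have "winv v @ l # u = []"
        using Cons.prems by (intro free_familyD[OF assms(1)]) (auto simp: image_Un)
      then show ?thesis by simp
    qed
  qed
qed

text \<open>Words with equal value have the same free reduction, and reducing a word does not change
  the value of its image under \<open>f\<close>.\<close>

lemma free_family_map_eq:
  assumes B: "free_family G B" and "group Q" and f: "f ` B \<subseteq> carrier Q"
    and u: "snd ` set u \<subseteq> B" and v: "snd ` set v \<subseteq> B" and eq: "word_eval G u = word_eval G v"
  shows "word_eval Q (map (apsnd f) u) = word_eval Q (map (apsnd f) v)"
proof -
  interpret Q: group Q by fact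
  have BG: "B \<subseteq> carrier G" using B by (auto simp: free_family_def)
  have "wred u = wred v"
    using u v BG eq snd_set_wred[of u] snd_set_wred[of v]
    by (intro reduced_word_unique[OF B]) (auto simp: word_reduced_wred word_eval_wred)
  moreover have "f ` (snd ` set u) \<subseteq> carrier Q" "f ` (snd ` set v) \<subseteq> carrier Q"
    using f u v by blast+
  ultimately show ?thesis
    using Q.word_eval_map_wred[of f u] Q.word_eval_map_wred[of f v] by simp
qed

end

section \<open>Homomorphisms out of a free subgroup\<close>

definition lift_map :: "('a, 'b) monoid_scheme \<Rightarrow> 'a set \<Rightarrow> ('q, 'c) monoid_scheme \<Rightarrow> ('a \<Rightarrow> 'q) \<Rightarrow> 'a \<Rightarrow> 'q" where
  "lift_map G B Q f g = word_eval Q (map (apsnd f) (SOME w. snd ` set w \<subseteq> B \<and> word_eval G w = g))"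

locale free_lift = group G + Q: group Q
  for G :: "('a, 'b) monoid_scheme" (structure) and Q :: "('q, 'c) monoid_scheme" +
  fixes B :: "'a set" and f :: "'a \<Rightarrow> 'q"
  assumes free: "free_family G B" and f_closed: "f ` B \<subseteq> carrier Q"
begin

abbreviation "L \<equiv> lift_map G B Q f"

lemma B_closed: "B \<subseteq> carrier G"
  using free by (auto simp: free_family_def)

lemma lift_word_eval:
  assumes "snd ` set w \<subseteq> B"
  shows "L (word_eval G w) = word_eval Q (map (apsnd f) w)"
proof -
  let ?v = "SOME v. snd ` set v \<subseteq> B \<and> word_eval G v = word_eval G w"
  have "snd ` set ?v \<subseteq> B \<and> word_eval G ?v = word_eval G w"
    using assms by (intro someI[of "\<lambda>v. snd ` set v \<subseteq> B \<and> word_eval G v = word_eval G w" w]) auto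
  then show ?thesis
    unfolding lift_map_def using assms Q.group_axioms
    by (intro free_family_map_eq[OF free _ f_closed]) auto
qed

lemma map_word_closed:
  assumes "snd ` set w \<subseteq> B" shows "snd ` set (map (apsnd f) w) \<subseteq> carrier Q"
  using assms f_closed by (force simp: image_subset_iff)

lemma lift_closed:
  assumes "g \<in> generate G B" shows "L g \<in> carrier Q"
  using generate_word[OF B_closed assms] map_word_closed Q.word_eval_closed lift_word_eval by metis

lemma lift_mult:
  assumes "g \<in> generate G B" "h \<in> generate G B"
  shows "L (g \<otimes> h) = L g \<otimes>\<^bsub>Q\<^esub> L h"
proof -
  obtain u v where u: "snd ` set u \<subseteq> B" "word_eval G u = g" and v: "snd ` set v \<subseteq> B" "word_eval G v = h"
    using generate_word[OF B_closed] assms by metis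
  have "g \<otimes> h = word_eval G (u @ v)"
    using u v B_closed by (subst word_eval_append) auto
  then show ?thesis
    using u v map_word_closed[of u] map_word_closed[of v]
      lift_word_eval[of "u @ v"] lift_word_eval[of u] lift_word_eval[of v]
    by (auto simp: Q.word_eval_append image_Un)
qed

lemma lift_one: "L \<one> = \<one>\<^bsub>Q\<^esub>"
  using lift_word_eval[of "[]"] by simp

lemma lift_inv:
  assumes "g \<in> generate G B" shows "L (inv g) = inv\<^bsub>Q\<^esub> (L g)"
proof -
  obtain u where u: "snd ` set u \<subseteq> B" "word_eval G u = g"
    using generate_word[OF B_closed] assms by metis
  have "inv g = word_eval G (winv u)"
    using u B_closed by (subst word_eval_winv) auto
  moreover have "map (apsnd f) (winv u) = winv (map (apsnd f) u)"
    by (simp add: winv_def rev_map)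
  ultimately show ?thesis
    using u map_word_closed[of u] lift_word_eval[of "winv u"] lift_word_eval[of u]
    by (simp add: Q.word_eval_winv)
qed

lemma lift_base: "b \<in> B \<Longrightarrow> L b = f b"
  using lift_word_eval[of "[(True, b)]"] B_closed f_closed
  by (simp add: word_eval_Cons subset_iff image_subset_iff)

text \<open>Here the letters are arbitrary elements of the free subgroup instead of basis elements.
  This is how a homomorphism defined through one basis is compared with words in another generating
  set or in the basis of a smaller subgroup.\<close>

lemma lift_word_eval_generate:
  assumes "snd ` set w \<subseteq> generate G B"
  shows "L (word_eval G w) = word_eval Q (map (apsnd L) w)"
  using assms
proof (induction w)
  case (Cons l w)
  have gB: "generate G (generate G B) \<subseteq> generate G B"
    using generate_is_subgroup[OF B_closed] generate_subgroup_incl by blast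
  have "word_eval G w \<in> generate G (generate G B)"
    using Cons.prems by (intro word_eval_in_generate) auto
  with gB have "word_eval G w \<in> generate G B" by blast
  moreover have "snd l \<in> generate G B" using Cons.prems by auto
  moreover have "inv (snd l) \<in> generate G B"
    using calculation(2) generate_m_inv_closed[OF B_closed] by blast
  ultimately show ?case
    using Cons by (auto simp: word_eval_Cons lift_mult lift_inv)
qed (simp add: lift_one)

end

section \<open>Free groups inside SL2\<close>

definition SL2 :: "('r::comm_ring_1 \<times> 'r \<times> 'r \<times> 'r) monoid" where
  "SL2 = \<lparr> carrier = {(a, b, c, d). a * d - b * c = 1},
     monoid.mult = (\<lambda>(a, b, c, d) (a', b', c', d').
       (a * a' + b * c', a * b' + b * d', c * a' + d * c', c * b' + d * d')),
     one = (1, 0, 0, 1) \<rparr>"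

text \<open>SL2 over the integers mod m, encoded by residues in \<open>{0..<m}\<close> so that
  finiteness of the carrier is immediate. Writing \<open>1 mod m\<close> also covers the trivial
  ring m = 1.\<close>

definition SL2_mod :: "int \<Rightarrow> (int \<times> int \<times> int \<times> int) monoid" where
  "SL2_mod m = \<lparr> carrier = {(a, b, c, d). {a, b, c, d} \<subseteq> {0..<m} \<and> (a * d - b * c) mod m = 1 mod m},
     monoid.mult = (\<lambda>(a, b, c, d) (a', b', c', d').
       ((a * a' + b * c') mod m, (a * b' + b * d') mod m,
        (c * a' + d * c') mod m, (c * b' + d * d') mod m)),
     one = (1 mod m, 0, 0, 1 mod m) \<rparr>"

lemma SL2_carrier: "(a, b, c, d) \<in> carrier SL2 \<longleftrightarrow> a * d - b * c = 1"
  by (simp add: SL2_def)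

lemma SL2_mult [simp]: "(a, b, c, d) \<otimes>\<^bsub>SL2\<^esub> (a', b', c', d') =
   (a * a' + b * c', a * b' + b * d', c * a' + d * c', c * b' + d * d')"
  by (simp add: SL2_def)

lemma SL2_one [simp]: "\<one>\<^bsub>SL2\<^esub> = (1, 0, 0, 1)"
  by (simp add: SL2_def)

lemma group_SL2: "group (SL2 :: ('r::comm_ring_1 \<times> 'r \<times> 'r \<times> 'r) monoid)"
proof (rule groupI)
  fix x y :: "'r \<times> 'r \<times> 'r \<times> 'r"
  assume "x \<in> carrier SL2" "y \<in> carrier SL2"
  then obtain a b c d a' b' c' d' where xy: "x = (a, b, c, d)" "y = (a', b', c', d')"
    "a * d - b * c = 1" "a' * d' - b' * c' = 1"
    by (cases x; cases y) (auto simp: SL2_carrier)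
  have "(a * a' + b * c') * (c * b' + d * d') - (a * b' + b * d') * (c * a' + d * c')
      = (a * d - b * c) * (a' * d' - b' * c')"
    by (simp add: algebra_simps)
  then show "x \<otimes>\<^bsub>SL2\<^esub> y \<in> carrier SL2" using xy by (simp add: SL2_carrier)
next
  fix x :: "'r \<times> 'r \<times> 'r \<times> 'r"
  assume "x \<in> carrier SL2"
  then obtain a b c d where x: "x = (a, b, c, d)" "a * d - b * c = 1"
    by (cases x) (auto simp: SL2_carrier)
  have "(d, -b, -c, a) \<in> carrier SL2" "(d, -b, -c, a) \<otimes>\<^bsub>SL2\<^esub> x = \<one>\<^bsub>SL2\<^esub>"
    using x by (auto simp: SL2_carrier algebra_simps)
  then show "\<exists>y\<in>carrier SL2. y \<otimes>\<^bsub>SL2\<^esub> x = \<one>\<^bsub>SL2\<^esub>" by blast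
next
  fix x y z :: "'r \<times> 'r \<times> 'r \<times> 'r"
  show "x \<otimes>\<^bsub>SL2\<^esub> y \<otimes>\<^bsub>SL2\<^esub> z = x \<otimes>\<^bsub>SL2\<^esub> (y \<otimes>\<^bsub>SL2\<^esub> z)"
    by (cases x; cases y; cases z) (simp add: algebra_simps)
qed (auto simp: SL2_carrier)

lemma SL2_inv:
  fixes a b c d :: "'r::comm_ring_1"
  assumes "a * d - b * c = 1"
  shows "inv\<^bsub>SL2\<^esub> (a, b, c, d) = (d, -b, -c, a)"
proof -
  interpret group "SL2 :: ('r \<times> 'r \<times> 'r \<times> 'r) monoid" by (rule group_SL2)
  show ?thesis
    by (rule inv_equality) (use assms in \<open>auto simp: SL2_carrier algebra_simps\<close>)
qed

lemma SL2_mod_mult [simp]: "(a, b, c, d) \<otimes>\<^bsub>SL2_mod m\<^esub> (a', b', c', d') =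
   ((a * a' + b * c') mod m, (a * b' + b * d') mod m, (c * a' + d * c') mod m, (c * b' + d * d') mod m)"
  by (simp add: SL2_mod_def)

lemma SL2_mod_one [simp]: "\<one>\<^bsub>SL2_mod m\<^esub> = (1 mod m, 0, 0, 1 mod m)"
  by (simp add: SL2_mod_def)

lemma SL2_mod_carrier: "(a, b, c, d) \<in> carrier (SL2_mod m) \<longleftrightarrow>
   {a, b, c, d} \<subseteq> {0..<m} \<and> (a * d - b * c) mod m = 1 mod m"
  by (simp add: SL2_mod_def)

lemma mod_sum_mult_eq:
  fixes a b c d m :: int
  shows "(a mod m * (b mod m) + c mod m * (d mod m)) mod m = (a * b + c * d) mod m"
    and "(a * (b mod m) + c * (d mod m)) mod m = (a * b + c * d) mod m"
    and "(a mod m * b + c mod m * d) mod m = (a * b + c * d) mod m"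
    and "(a mod m * (b mod m) - c mod m * (d mod m)) mod m = (a * b - c * d) mod m"
  by (auto intro!: mod_add_cong mod_diff_cong mod_mult_cong)

lemma group_SL2_mod:
  assumes "m > 0"
  shows "group (SL2_mod m)"
proof (rule groupI)
  fix x y :: "int \<times> int \<times> int \<times> int"
  assume "x \<in> carrier (SL2_mod m)" "y \<in> carrier (SL2_mod m)"
  then obtain a b c d a' b' c' d' where xy: "x = (a, b, c, d)" "y = (a', b', c', d')"
    "(a * d - b * c) mod m = 1 mod m" "(a' * d' - b' * c') mod m = 1 mod m"
    by (cases x; cases y) (auto simp: SL2_mod_carrier)
  have "((a * a' + b * c') * (c * b' + d * d') - (a * b' + b * d') * (c * a' + d * c')) mod m
      = ((a * d - b * c) * (a' * d' - b' * c')) mod m"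
    by (simp add: algebra_simps)
  also have "\<dots> = (((a * d - b * c) mod m) * ((a' * d' - b' * c') mod m)) mod m"
    by (simp only: mod_mult_eq)
  also have "\<dots> = 1 mod m"
    by (simp only: xy mod_mult_eq) simp
  finally show "x \<otimes>\<^bsub>SL2_mod m\<^esub> y \<in> carrier (SL2_mod m)"
    using xy(1,2) assms by (simp add: SL2_mod_carrier mod_sum_mult_eq)
next
  fix x :: "int \<times> int \<times> int \<times> int"
  assume "x \<in> carrier (SL2_mod m)"
  then obtain a b c d where x: "x = (a, b, c, d)" "(a * d - b * c) mod m = 1 mod m"
    by (cases x) (auto simp: SL2_mod_carrier)
  have "(d mod m, -b mod m, -c mod m, a mod m) \<in> carrier (SL2_mod m)"
    using x assms by (simp add: SL2_mod_carrier mod_sum_mult_eq mult.commute)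
  moreover have "(d mod m, -b mod m, -c mod m, a mod m) \<otimes>\<^bsub>SL2_mod m\<^esub> x = \<one>\<^bsub>SL2_mod m\<^esub>"
    using x by (simp add: mod_sum_mult_eq mult.commute)
  ultimately show "\<exists>y\<in>carrier (SL2_mod m). y \<otimes>\<^bsub>SL2_mod m\<^esub> x = \<one>\<^bsub>SL2_mod m\<^esub>" by blast
next
  fix x y z :: "int \<times> int \<times> int \<times> int"
  show "x \<otimes>\<^bsub>SL2_mod m\<^esub> y \<otimes>\<^bsub>SL2_mod m\<^esub> z = x \<otimes>\<^bsub>SL2_mod m\<^esub> (y \<otimes>\<^bsub>SL2_mod m\<^esub> z)"
    by (cases x; cases y; cases z) (simp add: mod_sum_mult_eq, simp add: algebra_simps)
qed (use assms in \<open>auto simp: SL2_mod_carrier mod_simps\<close>)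

lemma finite_SL2_mod: "finite (carrier (SL2_mod m))"
proof (rule finite_subset)
  show "carrier (SL2_mod m) \<subseteq> {0..<m} \<times> {0..<m} \<times> {0..<m} \<times> {0..<m}"
    by (auto simp: SL2_mod_def)
qed auto

lemma hom_word_eval:
  assumes "group_hom G Q h" "snd ` set w \<subseteq> carrier G"
  shows "h (word_eval G w) = word_eval Q (map (apsnd h) w)"
proof -
  interpret group_hom G Q h by fact
  show ?thesis
    using assms(2) by (induction w) (auto simp: word_eval_Cons G.word_eval_closed)
qed

lemma group_hom_SL2_mod:
  assumes "m > 0"
  shows "group_hom SL2 (SL2_mod m) (\<lambda>(a, b, c, d). (a mod m, b mod m, c mod m, d mod m))"
proof -
  have "(\<lambda>(a, b, c, d). (a mod m, b mod m, c mod m, d mod m)) \<in> hom SL2 (SL2_mod m)"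
    using assms by (auto simp: hom_def SL2_carrier SL2_mod_carrier mod_sum_mult_eq)
  then show ?thesis
    using group_SL2 group_SL2_mod[OF assms] by (simp add: group_hom_def group_hom_axioms_def)
qed

lemma group_hom_SL2_of_int:
  "group_hom SL2 (SL2 :: ('r::comm_ring_1 \<times> 'r \<times> 'r \<times> 'r) monoid)
     (\<lambda>(a, b, c, d). (of_int a, of_int b, of_int c, of_int d))"
proof -
  have "a * d - b * c = 1 \<Longrightarrow> (of_int a * of_int d - of_int b * of_int c :: 'r) = 1" for a b c d
    by (metis of_int_1 of_int_diff of_int_mult)
  then have "(\<lambda>(a, b, c, d). (of_int a, of_int b, of_int c, of_int d))
      \<in> hom SL2 (SL2 :: ('r \<times> 'r \<times> 'r \<times> 'r) monoid)"
    by (auto simp: hom_def SL2_carrier)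
  then show ?thesis
    by (intro group_hom.intro group_hom_axioms.intro group_SL2)
qed

text \<open>The parabolic element of SL2 fixing 4i: it moves every point at distance at least 1
  from 4i to distance at most 1/3 from 4i.\<close>

definition parab :: "nat \<Rightarrow> int \<times> int \<times> int \<times> int" where
  "parab i = (1 + 16 * int i, - 64 * (int i)\<^sup>2, 4, 1 - 16 * int i)"

lemma parab_carrier: "parab i \<in> carrier SL2"
  by (simp add: parab_def SL2_carrier algebra_simps power2_eq_square)

lemma parab_letter:
  "(if s then parab i else inv\<^bsub>SL2\<^esub> (parab i)) =
    (let e = (if s then 1 else -1) in
      (1 + 16 * e * int i, - 64 * e * (int i)\<^sup>2, 4 * e, 1 - 16 * e * int i))"
  using parab_carrier[of i] by (simp add: parab_def SL2_inv SL2_carrier)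

text \<open>Only the first column (a, c) is followed; a/c is the image of the point at infinity.
  With u = a - 4ic, the quotient u/c is the displacement of that point from the centre 4i of the
  first letter. The claim says, free of division, that the displacement is nonzero, at most 1/3 in
  size, and has the sign of the exponent of the first letter. The sign is what lets powers of one
  generator accumulate. Since c is then nonzero, the matrix is not the identity.\<close>

lemma ping_pong:
  assumes "word_reduced w" "w \<noteq> []" "inj_on idx (snd ` set w)"
  shows "\<exists>a b c d. word_eval SL2 (map (apsnd (\<lambda>x. parab (idx x))) w) = (a, b, c, d) \<and>
    (let u = a - 4 * int (idx (snd (hd w))) * c in
      u \<noteq> 0 \<and> 3 * \<bar>u\<bar> \<le> \<bar>c\<bar> \<and> (if fst (hd w) then 1 else -1) * (c * u) > 0)"
  using assms
proof (induction w)
  case (Cons l w)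
  obtain s x where l: "l = (s, x)" by (cases l)
  define i where "i = int (idx x)"
  define e :: int where "e = (if s then 1 else -1)"
  have e: "e = 1 \<or> e = -1" by (auto simp: e_def)
  obtain a b c d where M: "word_eval SL2 (map (apsnd (\<lambda>x. parab (idx x))) w) = (a, b, c, d)"
    by (cases "word_eval SL2 (map (apsnd (\<lambda>x. parab (idx x))) w)") auto
  define u where "u = a - 4 * i * c"
  \<comment> \<open>The point reached by \<open>w\<close> is either far from the new centre or near
    it on the side towards which the new letter pushes. It is far if \<open>w\<close> is empty (the
    point at infinity) or starts with another generator, as distinct centres are at least 4 apart
    and 4 - 1/3 exceeds 1. It is near if \<open>w\<close> starts with the same generator, and
    reducedness then forces the same sign.\<close>
  have pre: "u \<noteq> 0 \<and> (\<bar>c\<bar> \<le> \<bar>u\<bar> \<or> 3 * \<bar>u\<bar> \<le> \<bar>c\<bar> \<and> e * (c * u) > 0)"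
  proof (cases w)
    case Nil
    then show ?thesis using M by (auto simp: u_def)
  next
    case w: (Cons k v)
    obtain t y where k: "k = (t, y)" by (cases k)
    define j where "j = int (idx y)"
    define z where "z = a - 4 * j * c"
    have IH: "z \<noteq> 0" "3 * \<bar>z\<bar> \<le> \<bar>c\<bar>" "(if t then 1 else -1) * (c * z) > 0"
      using Cons.IH Cons.prems w k M
      by (auto simp: Let_def z_def j_def word_reduced_Cons)
    show ?thesis
    proof (cases "x = y")
      case True
      then have "s = t" using Cons.prems(1) w k l by simp
      with True IH show ?thesis by (simp add: u_def z_def i_def j_def e_def)
    next
      case False
      then have "i \<noteq> j"
        using Cons.prems(3) w k l by (auto simp: i_def j_def)
      then have "1 \<le> \<bar>j - i\<bar>" by auto
      then have "\<bar>c\<bar> \<le> \<bar>j - i\<bar> * \<bar>c\<bar>"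
        using mult_right_mono[of 1 "\<bar>j - i\<bar>" "\<bar>c\<bar>"] by simp
      then have "4 * \<bar>c\<bar> \<le> \<bar>4 * (j - i) * c\<bar>" by (simp add: abs_mult del: right_diff_distrib_numeral)
      moreover have "u = z + 4 * (j - i) * c" by (simp add: u_def z_def algebra_simps)
      ultimately have "\<bar>u\<bar> \<ge> 4 * \<bar>c\<bar> - \<bar>z\<bar>" by linarith
      then show ?thesis using IH(1,2) by linarith
    qed
  qed
  \<comment> \<open>In the coordinate c/u, the reciprocal of the displacement, the letter acts as
    translation by 4e, while \<open>u\<close> itself is unchanged.\<close>
  define c' where "c' = c + 4 * e * u"
  define a' where "a' = u + 4 * i * c'"
  have ee: "e * e = 1" using e by auto
  have cu: "e * (c' * u) = e * (c * u) + 4 * u\<^sup>2"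
  proof -
    have "e * (c' * u) = e * (c * u) + 4 * (e * e) * u\<^sup>2"
      by (simp add: c'_def algebra_simps power2_eq_square)
    then show ?thesis using ee by simp
  qed
  have new: "3 * \<bar>u\<bar> \<le> \<bar>c'\<bar> \<and> e * (c' * u) > 0"
    using pre
  proof (elim conjE disjE)
    assume u: "u \<noteq> 0" "\<bar>c\<bar> \<le> \<bar>u\<bar>"
    have "3 * \<bar>u\<bar> \<le> \<bar>c'\<bar>" using u e by (auto simp: c'_def)
    moreover have "\<bar>e * (c * u)\<bar> \<le> u\<^sup>2"
      using u(2) e mult_right_mono[of "\<bar>c\<bar>" "\<bar>u\<bar>" "\<bar>u\<bar>"]
      by (auto simp: abs_mult power2_eq_square)
    moreover have "u\<^sup>2 > 0" using u by simp
    ultimately show ?thesis using cu by linarith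
  next
    assume u: "u \<noteq> 0" "3 * \<bar>u\<bar> \<le> \<bar>c\<bar>" "e * (c * u) > 0"
    have "u\<^sup>2 > 0" using u by simp
    then have 1: "e * (c' * u) > 0" using cu u by linarith
    have "c * (e * u) > 0" using u(3) by (simp add: algebra_simps)
    then have "3 * \<bar>u\<bar> \<le> \<bar>c'\<bar>"
      using u(2) e by (auto simp: c'_def zero_less_mult_iff)
    with 1 show ?thesis by simp
  qed
  have "word_eval SL2 (map (apsnd (\<lambda>x. parab (idx x))) (l # w)) =
     (1 + 16 * e * i, - 64 * e * i\<^sup>2, 4 * e, 1 - 16 * e * i) \<otimes>\<^bsub>SL2\<^esub> (a, b, c, d)"
    using M parab_letter[of s "idx x"]
    by (simp only: word_eval_Cons l e_def i_def Let_def list.map apsnd_conv fst_conv snd_conv)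
  moreover have "(1 + 16 * e * i) * a + (- 64 * e * i\<^sup>2) * c = a'"
    by (simp add: a'_def c'_def u_def algebra_simps power2_eq_square)
  moreover have "4 * e * a + (1 - 16 * e * i) * c = c'"
    by (simp add: c'_def u_def algebra_simps)
  ultimately have "\<exists>b' d'. word_eval SL2 (map (apsnd (\<lambda>x. parab (idx x))) (l # w)) = (a', b', c', d')"
    by simp
  moreover have "a' - 4 * i * c' = u" by (simp add: a'_def)
  ultimately show ?case using new pre l by (auto simp: Let_def i_def e_def)
qed simp

text \<open>The type of generators may be uncountable, so only the finitely many letters of the
  given word are numbered; distinct letters receive parabolic elements with distinct
  centres.\<close>

lemma SL2_int_separates:
  assumes "word_reduced w" "w \<noteq> []"
  obtains f :: "'a \<Rightarrow> int \<times> int \<times> int \<times> int"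
  where "range f \<subseteq> carrier SL2" "word_eval SL2 (map (apsnd f) w) \<noteq> \<one>\<^bsub>SL2\<^esub>"
proof -
  obtain idx :: "'a \<Rightarrow> nat" where "inj_on idx (snd ` set w)"
    using finite_imp_inj_to_nat_seg[of "snd ` set w"] by auto
  from ping_pong[OF assms this] show thesis
    using parab_carrier by (intro that[of "\<lambda>x. parab (idx x)"]) (auto simp: Let_def)
qed

lemma SL2_real_separates:
  assumes "word_reduced w" "w \<noteq> []"
  obtains f :: "'a \<Rightarrow> real \<times> real \<times> real \<times> real"
  where "range f \<subseteq> carrier SL2" "word_eval SL2 (map (apsnd f) w) \<noteq> \<one>\<^bsub>SL2\<^esub>"
proof -
  obtain f :: "'a \<Rightarrow> int \<times> int \<times> int \<times> int"
    where f: "range f \<subseteq> carrier SL2" "word_eval SL2 (map (apsnd f) w) \<noteq> \<one>\<^bsub>SL2\<^esub>"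
    using SL2_int_separates[OF assms] .
  define h :: "int \<times> int \<times> int \<times> int \<Rightarrow> real \<times> real \<times> real \<times> real"
    where "h = (\<lambda>(a, b, c, d). (of_int a, of_int b, of_int c, of_int d))"
  interpret h: group_hom SL2 SL2 h unfolding h_def by (rule group_hom_SL2_of_int)
  have "h (word_eval SL2 (map (apsnd f) w)) = word_eval SL2 (map (apsnd (h \<circ> f)) w)"
    using f(1) hom_word_eval[OF h.group_hom_axioms, of "map (apsnd f) w"]
    by (simp add: apsnd_compose comp_def image_subset_iff)
  moreover have "h M \<noteq> \<one>\<^bsub>SL2\<^esub>" if "M \<noteq> \<one>\<^bsub>SL2\<^esub>" for M
    using that by (cases M) (auto simp: h_def)
  moreover have "range (h \<circ> f) \<subseteq> carrier SL2" using f(1) by (auto intro: h.hom_closed)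
  ultimately show thesis using f(2) that[of "h \<circ> f"] by metis
qed

lemma free_residually_finite:
  assumes "word_reduced w" "w \<noteq> []"
  obtains m and f :: "'a \<Rightarrow> int \<times> int \<times> int \<times> int"
  where "m > 0" "range f \<subseteq> carrier (SL2_mod m)"
    "word_eval (SL2_mod m) (map (apsnd f) w) \<noteq> \<one>\<^bsub>SL2_mod m\<^esub>"
proof -
  obtain f :: "'a \<Rightarrow> int \<times> int \<times> int \<times> int"
    where f: "range f \<subseteq> carrier SL2" "word_eval SL2 (map (apsnd f) w) \<noteq> \<one>\<^bsub>SL2\<^esub>"
    using SL2_int_separates[OF assms] .
  obtain a b c d where M: "word_eval SL2 (map (apsnd f) w) = (a, b, c, d)"
    by (cases "word_eval SL2 (map (apsnd f) w)")
  \<comment> \<open>The modulus exceeds the absolute value of each entry by at least 2, so no entry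
    different from 0 or 1 can become congruent to it.\<close>
  define m where "m = 2 + \<bar>a\<bar> + \<bar>b\<bar> + \<bar>c\<bar> + \<bar>d\<bar>"
  have m: "m > 0" by (simp add: m_def)
  define h :: "int \<times> int \<times> int \<times> int \<Rightarrow> int \<times> int \<times> int \<times> int"
    where "h = (\<lambda>(a, b, c, d). (a mod m, b mod m, c mod m, d mod m))"
  interpret h: group_hom SL2 "SL2_mod m" h unfolding h_def by (rule group_hom_SL2_mod[OF m])
  have "h (word_eval SL2 (map (apsnd f) w)) = word_eval (SL2_mod m) (map (apsnd (h \<circ> f)) w)"
    using f(1) hom_word_eval[OF h.group_hom_axioms, of "map (apsnd f) w"]
    by (simp add: apsnd_compose comp_def image_subset_iff)
  moreover have eq: "z = z'" if "z mod m = z' mod m" "\<bar>z - z'\<bar> < m" for z z'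
    using that by (metis dvd_imp_le_int mod_eq_dvd_iff abs_of_pos eq_iff_diff_eq_0 linorder_not_less m)
  have "h (a, b, c, d) \<noteq> \<one>\<^bsub>SL2_mod m\<^esub>"
  proof
    assume "h (a, b, c, d) = \<one>\<^bsub>SL2_mod m\<^esub>"
    then have "a mod m = 1 mod m" "b mod m = 0 mod m" "c mod m = 0 mod m" "d mod m = 1 mod m"
      by (auto simp: h_def)
    moreover have "\<bar>a - 1\<bar> < m" "\<bar>b - 0\<bar> < m" "\<bar>c - 0\<bar> < m" "\<bar>d - 1\<bar> < m"
      by (auto simp: m_def)
    ultimately have "a = 1 \<and> b = 0 \<and> c = 0 \<and> d = 1"
      using eq by blast
    then show False using f(2) M by simp
  qed
  moreover have "range (h \<circ> f) \<subseteq> carrier (SL2_mod m)" using f(1) by (auto intro: h.hom_closed)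
  ultimately show thesis using m M that[of m "h \<circ> f"] by metis
qed

section \<open>Rank\<close>

context group
begin

lemma generate_subset_iff:
  assumes "C \<subseteq> carrier G" "B \<subseteq> carrier G"
  shows "generate G C \<subseteq> generate G B \<longleftrightarrow> C \<subseteq> generate G B"
  using assms generate_is_subgroup[of B] generate_subgroup_incl[of C "generate G B"]
  by (auto intro: generate.incl)

lemma generate_Un_cong:
  assumes "A \<subseteq> carrier G" "B \<subseteq> carrier G" "C \<subseteq> carrier G" "generate G A = generate G B"
  shows "generate G (A \<union> C) = generate G (B \<union> C)"
proof -
  have "generate G (S \<union> C) \<subseteq> generate G (T \<union> C)"
    if "S \<subseteq> carrier G" "T \<subseteq> carrier G" "generate G S = generate G T" for S T
  proof -
    have "S \<subseteq> generate G T" using that generate_subset_iff by blast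
    then have "S \<union> C \<subseteq> generate G (T \<union> C)"
      using mono_generate[of T "T \<union> C"] by (auto intro: generate.incl)
    then show ?thesis using that assms by (subst generate_subset_iff) auto
  qed
  from this[of A B] this[of B A] show ?thesis using assms by simp
qed

text \<open>An element b of \<open>B\<close> outside \<open>C\<close> would have two reduced
  spellings over \<open>B\<close>: the single letter b, and a word over \<open>C\<close>.\<close>

lemma generate_free_eq_subset:
  assumes "free_family G B" "C \<subseteq> B" "B \<subseteq> generate G C"
  shows "B = C"
proof (rule ccontr)
  assume "B \<noteq> C"
  then obtain b where b: "b \<in> B" "b \<notin> C" using assms by auto
  have BG: "B \<subseteq> carrier G" using assms(1) by (auto simp: free_family_def)
  then obtain w where w: "word_reduced w" "snd ` set w \<subseteq> C" "word_eval G w = b"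
    using generate_word[of C b] assms b by blast
  have "w = [(True, b)]"
    using w assms b BG by (intro reduced_word_unique[OF assms(1)]) (auto simp: word_eval_Cons)
  then show False using w b by simp
qed

text \<open>Spelling the finitely many generators in \<open>S\<close> uses only finitely many
  letters of \<open>B\<close>. These letters already generate \<open>B\<close>, so by minimality
  they are all of it.\<close>

lemma finite_basis:
  assumes B: "free_family G B" and S: "finite S" "S \<subseteq> generate G B" "B \<subseteq> generate G S"
  shows "finite B"
proof -
  have BG: "B \<subseteq> carrier G" using B by (auto simp: free_family_def)
  have "\<forall>s\<in>S. \<exists>w. snd ` set w \<subseteq> B \<and> word_eval G w = s"
    using generate_word[OF BG] S(2) by (metis subsetD)
  then obtain W where W: "\<forall>s\<in>S. snd ` set (W s) \<subseteq> B \<and> word_eval G (W s) = s" by metis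
  define C where "C = (\<Union>s\<in>S. snd ` set (W s))"
  have C: "C \<subseteq> B" "finite C" using W S by (auto simp: C_def)
  have "s \<in> generate G C" if "s \<in> S" for s
    using word_eval_in_generate[of "W s" C] W that by (auto simp: C_def)
  then have "S \<subseteq> generate G C" by auto
  moreover have "S \<subseteq> carrier G" "C \<subseteq> carrier G"
    using S(2) C(1) BG generate_in_carrier[OF BG] by blast+
  ultimately have "B \<subseteq> generate G C"
    using S(3) generate_subset_iff[of S C] by auto
  then have "B = C" using generate_free_eq_subset[OF B C(1)] by simp
  with C show ?thesis by simp
qed

text \<open>Restricting homomorphisms into a finite group Q to a generating set C injects
  the assignments from B to Q into the assignments from C to Q; if B and C have equal size,
  every assignment on C is attained, so C satisfies no relation that fails in Q.\<close>

lemma lift_restrict_inj: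
  assumes B: "free_family G B" and C: "C \<subseteq> generate G B" "B \<subseteq> generate G C" and Q: "group Q"
  shows "inj_on (\<lambda>f. restrict (lift_map G B Q f) C) (B \<rightarrow>\<^sub>E carrier Q)"
proof (rule inj_onI)
  fix f g assume f: "f \<in> B \<rightarrow>\<^sub>E carrier Q" and g: "g \<in> B \<rightarrow>\<^sub>E carrier Q"
    and eq: "restrict (lift_map G B Q f) C = restrict (lift_map G B Q g) C"
  interpret F: free_lift G Q B f
    using B Q f by (auto simp: free_lift_def free_lift_axioms_def group_axioms)
  interpret H: free_lift G Q B g
    using B Q g by (auto simp: free_lift_def free_lift_axioms_def group_axioms)
  have CG: "C \<subseteq> carrier G" using C(1) generate_in_carrier[OF F.B_closed] by blast
  have "f b = g b" if "b \<in> B" for b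
  proof -
    have "b \<in> generate G C" using C(2) that by blast
    then obtain w where "word_reduced w" and w: "snd ` set w \<subseteq> C" "word_eval G w = b"
      by (rule generate_word[OF CG])
    have LC: "F.L c = H.L c" if "c \<in> C" for c using fun_cong[OF eq, of c] that by simp
    have "map (apsnd F.L) w = map (apsnd H.L) w"
      using w(1) LC by (auto simp: image_subset_iff)
    moreover have "snd ` set w \<subseteq> generate G B" using w(1) C(1) by blast
    ultimately have "F.L b = H.L b"
      using F.lift_word_eval_generate[of w] H.lift_word_eval_generate[of w] w(2) by metis
    then show ?thesis using that F.lift_base H.lift_base by simp
  qed
  then show "f = g" using f g by (intro PiE_ext) auto
qed

text \<open>The second claim is the Hopfian property of finitely generated free groups, in the form
  needed to control ranks.\<close>

lemma card_basis_le:
  assumes B: "free_family G B" "finite B" and C: "finite C" "C \<subseteq> generate G B" "B \<subseteq> generate G C"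
  shows "card B \<le> card C" and "card B = card C \<Longrightarrow> free_family G C"
proof -
  have BG: "B \<subseteq> carrier G" using B by (auto simp: free_family_def)
  have CG: "C \<subseteq> carrier G" using C(2) generate_in_carrier[OF BG] by blast
  let ?R = "\<lambda>m f. restrict (lift_map G B (SL2_mod m) f) C"
  have sub: "?R m ` (B \<rightarrow>\<^sub>E carrier (SL2_mod m)) \<subseteq> (C \<rightarrow>\<^sub>E carrier (SL2_mod m))" if "m > 0" for m
  proof clarify
    fix f assume f: "f \<in> B \<rightarrow>\<^sub>E carrier (SL2_mod m)"
    interpret F: free_lift G "SL2_mod m" B f
      using B f group_SL2_mod[OF that] by (auto simp: free_lift_def free_lift_axioms_def group_axioms)
    show "restrict F.L C \<in> C \<rightarrow>\<^sub>E carrier (SL2_mod m)"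
      using C(2) F.lift_closed by auto
  qed
  have fin: "finite (C \<rightarrow>\<^sub>E carrier (SL2_mod m))" for m
    using C(1) finite_SL2_mod by (intro finite_PiE) auto
  have inj: "inj_on (?R m) (B \<rightarrow>\<^sub>E carrier (SL2_mod m))" if "m > 0" for m
    using lift_restrict_inj[OF B(1) C(2,3) group_SL2_mod[OF that]] .
  \<comment> \<open>Comparing the numbers of assignments into a nontrivial finite group turns the
    injection into an inequality between powers of one base greater than 1, hence between
    exponents.\<close>
  have "card (B \<rightarrow>\<^sub>E carrier (SL2_mod 2)) \<le> card (C \<rightarrow>\<^sub>E carrier (SL2_mod 2))"
    using card_inj_on_le[OF inj sub fin] by simp
  then have "card (carrier (SL2_mod 2)) ^ card B \<le> card (carrier (SL2_mod 2)) ^ card C"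
    using B C by (simp add: card_PiE)
  moreover have "card (carrier (SL2_mod 2)) > 1"
  proof -
    have "{(1, 0, 0, 1), (1, 1, 0, 1)} \<subseteq> carrier (SL2_mod 2)" by (auto simp: SL2_mod_carrier)
    then have "card {(1, 0, 0, 1), (1, 1, 0, 1) :: int \<times> int \<times> int \<times> int} \<le> card (carrier (SL2_mod 2))"
      by (intro card_mono finite_SL2_mod)
    then show ?thesis by simp
  qed
  ultimately show "card B \<le> card C" by (simp add: power_increasing_iff)
  show "free_family G C" if eq: "card B = card C"
    unfolding free_family_def
  proof (intro conjI allI impI notI CG)
    fix u assume u: "u \<noteq> [] \<and> word_reduced u \<and> snd ` set u \<subseteq> C" "word_eval G u = \<one>"
    \<comment> \<open>Residual finiteness supplies an assignment on the letters of \<open>u\<close>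
      under which \<open>u\<close> is nontrivial. By surjectivity of restriction, its values on
      \<open>C\<close> come from a homomorphism of the whole subgroup, which must send the relation
      \<open>u\<close> to the identity.\<close>
    obtain m and f :: "'a \<Rightarrow> int \<times> int \<times> int \<times> int"
      where f: "m > 0" "range f \<subseteq> carrier (SL2_mod m)"
        "word_eval (SL2_mod m) (map (apsnd f) u) \<noteq> \<one>\<^bsub>SL2_mod m\<^esub>"
      using free_residually_finite[of u] u(1) by blast
    have "card (?R m ` (B \<rightarrow>\<^sub>E carrier (SL2_mod m))) = card (C \<rightarrow>\<^sub>E carrier (SL2_mod m))"
      using inj[OF f(1)] B C eq by (simp add: card_image card_PiE)
    then have "?R m ` (B \<rightarrow>\<^sub>E carrier (SL2_mod m)) = (C \<rightarrow>\<^sub>E carrier (SL2_mod m))"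
      using card_subset_eq[OF fin sub[OF f(1)]] by simp
    moreover have "restrict f C \<in> C \<rightarrow>\<^sub>E carrier (SL2_mod m)" using f(2) by auto
    ultimately obtain g where g: "g \<in> B \<rightarrow>\<^sub>E carrier (SL2_mod m)" "restrict f C = ?R m g"
      by blast
    interpret F: free_lift G "SL2_mod m" B g
      using B g group_SL2_mod[OF f(1)] by (auto simp: free_lift_def free_lift_axioms_def group_axioms)
    have "f c = F.L c" if "c \<in> C" for c using fun_cong[OF g(2), of c] that by simp
    then have "map (apsnd f) u = map (apsnd F.L) u" using u(1) by (auto simp: image_subset_iff)
    moreover have "snd ` set u \<subseteq> generate G B" using u(1) C(2) by blast
    ultimately have "word_eval (SL2_mod m) (map (apsnd f) u) = F.L (word_eval G u)"
      using F.lift_word_eval_generate[of u] by metis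
    then show False using u(2) f(3) F.lift_one by simp
  qed
qed

end

section \<open>Exchange in free families and passage to subgroups\<close>

context group
begin

text \<open>Each maximal block of letters from \<open>Z\<close> is rewritten over \<open>P\<close>,
  while letters from \<open>R\<close> stay. The clause about heads is the induction invariant that
  rules out cancellation at the junctions: a rewritten block meets only letters from the disjoint
  alphabet \<open>R\<close>, and adjacent letters from \<open>R\<close> are the original
  ones.\<close>

lemma word_replace:
  assumes PR: "free_family G (P \<union> R)" "P \<inter> R = {}"
    and Z: "free_family G Z" "Z \<subseteq> generate G P" "Z \<inter> R = {}"
    and w: "word_reduced w" "snd ` set w \<subseteq> Z \<union> R"
  shows "\<exists>w'. word_reduced w' \<and> snd ` set w' \<subseteq> P \<union> R \<and> word_eval G w' = word_eval G w \<and>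
    (w = [] \<longleftrightarrow> w' = []) \<and>
    (w \<noteq> [] \<longrightarrow> (if snd (hd w) \<in> R then hd w' = hd w else snd (hd w') \<in> P))"
  using w
proof (induction w rule: measure_induct_rule[where f = length])
  case (less w)
  have G: "P \<subseteq> carrier G" "R \<subseteq> carrier G" "Z \<subseteq> carrier G"
    using PR Z by (auto simp: free_family_def)
  consider "w = []" | l v where "w = l # v" "snd l \<in> R" | l v where "w = l # v" "snd l \<in> Z"
    using less.prems(2) by (cases w) auto
  then show ?case
  proof cases
    case 1
    then show ?thesis by (intro exI[of _ "[]"]) auto
  next
    case 2
    have "word_reduced v" "snd ` set v \<subseteq> Z \<union> R" "length v < length w"
      using less.prems 2 by (auto simp: word_reduced_Cons)
    from less.IH[OF this(3,1,2)] obtain v' where v': "word_reduced v'" "snd ` set v' \<subseteq> P \<union> R"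
      "word_eval G v' = word_eval G v" "v = [] \<longleftrightarrow> v' = []"
      "v \<noteq> [] \<longrightarrow> (if snd (hd v) \<in> R then hd v' = hd v else snd (hd v') \<in> P)" by blast
    have "word_reduced (l # v')"
    proof (cases "v = []")
      case False
      show ?thesis
      proof (cases "snd (hd v) \<in> R")
        case True
        then show ?thesis using v' False less.prems(1) 2 by (auto simp: word_reduced_Cons)
      next
        case notR: False
        then have "snd (hd v') \<noteq> snd l" using v'(5) False 2 PR(2) by auto
        then show ?thesis using v' by (auto simp: word_reduced_Cons)
      qed
    qed (use v' in \<open>auto simp: word_reduced_Cons\<close>)
    then show ?thesis
      using v' 2 by (intro exI[of _ "l # v'"]) (auto simp: word_eval_Cons)
  next
    case 3
    define u where "u = takeWhile (\<lambda>x. snd x \<in> Z) w"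
    define v where "v = dropWhile (\<lambda>x. snd x \<in> Z) w"
    have w: "w = u @ v" by (simp add: u_def v_def)
    have u: "u \<noteq> []" "hd u = l" using 3 by (auto simp: u_def)
    have uZ: "snd ` set u \<subseteq> Z" by (auto simp: u_def dest: set_takeWhileD)
    have vR: "v \<noteq> [] \<longrightarrow> snd (hd v) \<in> R"
    proof
      assume v: "v \<noteq> []"
      then have "snd (hd v) \<notin> Z" unfolding v_def by (rule hd_dropWhile)
      moreover have "snd (hd v) \<in> Z \<union> R" using less.prems(2) v w by (auto simp: image_subset_iff)
      ultimately show "snd (hd v) \<in> R" by simp
    qed
    have red: "word_reduced u" "word_reduced v" "snd ` set v \<subseteq> Z \<union> R" "length v < length w"
      using less.prems u(1) by (auto simp: w word_reduced_append)
    from less.IH[OF red(4,2,3)] obtain v' where v': "word_reduced v'" "snd ` set v' \<subseteq> P \<union> R"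
      "word_eval G v' = word_eval G v" "v = [] \<longleftrightarrow> v' = []"
      "v \<noteq> [] \<longrightarrow> (if snd (hd v) \<in> R then hd v' = hd v else snd (hd v') \<in> P)" by blast
    have "word_eval G u \<in> generate G Z" using uZ by (rule word_eval_in_generate)
    then have "word_eval G u \<in> generate G P" using Z(2) G generate_subset_iff[of Z P] by blast
    then obtain p where p: "word_reduced p" "snd ` set p \<subseteq> P" "word_eval G p = word_eval G u"
      by (rule generate_word[OF G(1)])
    \<comment> \<open>A block over the free family \<open>Z\<close> has nontrivial value, so its
      rewriting cannot vanish and bring the letters of \<open>R\<close> on its two sides into
      contact.\<close>
    have "word_eval G u \<noteq> \<one>" using Z(1) u(1) red(1) uZ by (auto simp: free_family_def)
    then have pne: "p \<noteq> []" using p by auto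
    have "snd (last p) \<in> P" "snd (hd p) \<in> P" using p(2) pne last_in_set hd_in_set by blast+
    then have "word_reduced (p @ v')"
      using p v' vR PR(2) by (auto simp: word_reduced_append)
    moreover have "word_eval G (p @ v') = word_eval G (u @ v)"
      using p(2,3) v'(2,3) uZ red(3) G by (subst (1 2) word_eval_append) auto
    moreover have "snd l \<notin> R" using 3 Z(3) by auto
    ultimately show ?thesis
      using p v' pne u \<open>snd (hd p) \<in> P\<close> by (intro exI[of _ "p @ v'"]) (auto simp: w image_Un)
  qed
qed

text \<open>In the free product of the subgroups generated by \<open>P\<close> and \<open>R\<close>,
  a subgroup of the first factor and the second factor still generate their free product. Read
  contrapositively, with \<open>R\<close> a single element, a dependence on \<open>Z\<close>
  persists over every basis of a larger free subgroup.\<close>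

lemma free_family_replace:
  assumes PR: "free_family G (P \<union> R)" "P \<inter> R = {}"
    and Z: "free_family G Z" "Z \<subseteq> generate G P" "Z \<inter> R = {}"
  shows "free_family G (Z \<union> R)"
  unfolding free_family_def
proof (intro conjI allI impI)
  show "Z \<union> R \<subseteq> carrier G" using PR Z by (auto simp: free_family_def)
  fix w assume w: "w \<noteq> [] \<and> word_reduced w \<and> snd ` set w \<subseteq> Z \<union> R"
  then obtain w' where "word_reduced w'" "snd ` set w' \<subseteq> P \<union> R" "word_eval G w' = word_eval G w" "w' \<noteq> []"
    using word_replace[OF assms, of w] by blast
  then show "word_eval G w \<noteq> \<one>" using PR(1) by (auto simp: free_family_def)
qed

lemma word_eval_subgroup_generated:
  assumes "snd ` set w \<subseteq> carrier (subgroup_generated G A)"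
  shows "word_eval (subgroup_generated G A) w = word_eval G w"
  using assms by (induction w) (auto simp: word_eval_Cons)

lemma free_basis_subgroup_generated_iff:
  "free_basis (subgroup_generated G A) B \<longleftrightarrow>
     free_family G B \<and> generate G B = generate G (carrier G \<inter> A)"
proof -
  define H where "H = generate G (carrier G \<inter> A)"
  have H: "subgroup H G" "carrier (subgroup_generated G A) = H"
    unfolding H_def by (auto intro: generate_is_subgroup simp: carrier_subgroup_generated)
  have gen: "generate (subgroup_generated G A) B = generate G B" if "B \<subseteq> H"
    using generate_consistent[OF that H(1)] by (simp add: subgroup_generated_def H_def)
  have ev: "word_eval (subgroup_generated G A) w = word_eval G w" if "snd ` set w \<subseteq> B" "B \<subseteq> H" for w
    using that H(2) by (intro word_eval_subgroup_generated) auto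
  have "B \<subseteq> H \<Longrightarrow> B \<subseteq> carrier G" using subgroup.subset[OF H(1)] by auto
  moreover have "generate G B = H \<Longrightarrow> B \<subseteq> H" by (auto intro: generate.incl)
  ultimately show ?thesis
    unfolding free_basis_def free_family_def H(2) H_def[symmetric] one_subgroup_generated
    using gen ev by auto
qed

end

lemma locally_free_basis:
  assumes "locally_free G" "finite S" "S \<subseteq> carrier G"
  obtains B where "free_family G B" "finite B" "generate G B = generate G S"
proof -
  interpret group G using assms(1) by (simp add: locally_free_def)
  have "free_group (subgroup_generated G (generate G S))"
    using assms by (auto simp: locally_free_def fin_gen_subgroup_def)
  then obtain B where "free_family G B" "generate G B = generate G (carrier G \<inter> generate G S)"
    by (auto simp: free_group_def free_basis_subgroup_generated_iff)
  moreover have "carrier G \<inter> generate G S = generate G S"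
    using generate_in_carrier[OF assms(3)] by blast
  moreover have "generate G (generate G S) = generate G S"
    using generate_subset_iff[of "generate G S" S] generate_in_carrier[OF assms(3)] assms(3)
    by (auto intro: generate.incl)
  ultimately have B: "free_family G B" "generate G B = generate G S" by auto
  moreover have "finite B"
  proof (rule finite_basis[OF B(1) assms(2)])
    show "S \<subseteq> generate G B" unfolding B(2) by (auto intro: generate.incl)
    show "B \<subseteq> generate G S" unfolding B(2)[symmetric] by (auto intro: generate.incl)
  qed
  ultimately show thesis using that by blast
qed

text \<open>The elements of \<open>Z\<close> are listed separately, because inserting one of them
  into a free \<open>Z\<close> leaves it free.\<close>

definition dependents :: "('a, 'b) monoid_scheme \<Rightarrow> 'a set \<Rightarrow> 'a set" where
  "dependents G Z = {g \<in> carrier G. g \<in> Z \<or> \<not> free_family G (insert g Z)}"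

text \<open>A relation of \<open>g\<close> over \<open>Z\<close> is also a relation over any basis \<open>B\<close> of a larger subgroup,
  so adjoining \<open>g\<close> cannot raise the rank.\<close>

lemma dependents_rank_le:
  assumes G: "locally_free G" and Z: "free_family G Z" "finite Z"
    and T: "finite T" "T \<subseteq> dependents G Z"
  shows "\<exists>B. free_family G B \<and> finite B \<and> card B \<le> card Z \<and> generate G B = generate G (Z \<union> T)"
  using T
proof (induction T rule: finite_induct)
  case empty
  then show ?case using Z by auto
next
  case (insert g T)
  interpret group G using G by (simp add: locally_free_def)
  have ZG: "Z \<subseteq> carrier G" using Z by (auto simp: free_family_def)
  have TG: "T \<subseteq> carrier G" "g \<in> carrier G" using insert.prems by (auto simp: dependents_def)
  obtain B where B: "free_family G B" "finite B" "card B \<le> card Z" "generate G B = generate G (Z \<union> T)"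
    using insert by auto
  have BG: "B \<subseteq> carrier G" using B by (auto simp: free_family_def)
  obtain B' where B': "free_family G B'" "finite B'" "generate G B' = generate G (Z \<union> insert g T)"
    using locally_free_basis[OF G, of "Z \<union> insert g T"] Z(2) insert.hyps(1) ZG TG by auto
  have "generate G (insert g B) = generate G B'"
    using generate_Un_cong[of B "Z \<union> T" "{g}"] B(4) B'(3) BG ZG TG by simp
  moreover have "insert g B \<subseteq> generate G (insert g B)" "B' \<subseteq> generate G B'"
    by (auto intro: generate.incl)
  ultimately have gB: "insert g B \<subseteq> generate G B'" "B' \<subseteq> generate G (insert g B)"
    by auto
  show ?case
  proof (cases "g \<in> Z")
    case True
    then have "Z \<union> insert g T = Z \<union> T" by auto
    then show ?thesis using B by auto
  next
    case gZ: False
    note cb = card_basis_le[OF B'(1,2) _ gB]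
    \<comment> \<open>If the rank exceeded \<open>card Z\<close>, then \<open>card B'\<close> would
      be \<open>card B + 1\<close>, so the generating set \<open>insert g B\<close> would have the
      size of a basis and hence be free. Exchanging \<open>B\<close> for \<open>Z\<close> would then
      make \<open>g\<close> independent of \<open>Z\<close>.\<close>
    have "card B' \<le> card Z"
    proof (rule ccontr)
      assume "\<not> card B' \<le> card Z"
      moreover have "card B' \<le> card (insert g B)" using cb(1) B(2) by simp
      ultimately have "g \<notin> B" using B(3) by (metis insert_absorb le_trans)
      then have "card (insert g B) = Suc (card B)" using B(2) by simp
      then have "card B' = card (insert g B)"
        using B(3) \<open>card B' \<le> card (insert g B)\<close> \<open>\<not> card B' \<le> card Z\<close> by linarith
      then have "free_family G (B \<union> {g})" using cb(2) B(2) by simp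
      moreover have "Z \<subseteq> generate G B" using B(4) by (auto intro: generate.incl)
      ultimately have "free_family G (Z \<union> {g})"
        using Z gZ \<open>g \<notin> B\<close> free_family_replace[of B "{g}" Z] by auto
      then show False using insert.prems gZ by (auto simp: dependents_def)
    qed
    then show ?thesis using B' by auto
  qed
qed

section \<open>Algebraic dependence\<close>

text \<open>Polynomials over the rationals in arbitrarily many variables, kept as syntax: there are
  only countably many expressions, and one expression can be evaluated at many real points.\<close>

datatype pexp = PConst rat | PVar nat | PAdd pexp pexp | PMul pexp pexp

instance pexp :: countable
  by countable_datatype

primrec peval :: "pexp \<Rightarrow> (nat \<Rightarrow> real) \<Rightarrow> real" where
  "peval (PConst c) x = of_rat c"
| "peval (PVar i) x = x i"
| "peval (PAdd p q) x = peval p x + peval q x"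
| "peval (PMul p q) x = peval p x * peval q x"

primrec pvars :: "pexp \<Rightarrow> nat set" where
  "pvars (PConst c) = {}"
| "pvars (PVar i) = {i}"
| "pvars (PAdd p q) = pvars p \<union> pvars q"
| "pvars (PMul p q) = pvars p \<union> pvars q"

text \<open>A syntactic upper bound for the degree; cancellation may make the actual degree
  smaller.\<close>

primrec pdeg :: "pexp \<Rightarrow> nat" where
  "pdeg (PConst c) = 0"
| "pdeg (PVar i) = 1"
| "pdeg (PAdd p q) = max (pdeg p) (pdeg q)"
| "pdeg (PMul p q) = pdeg p + pdeg q"

primrec psubst :: "(nat \<Rightarrow> pexp) \<Rightarrow> pexp \<Rightarrow> pexp" where
  "psubst s (PConst c) = PConst c"
| "psubst s (PVar i) = s i"
| "psubst s (PAdd p q) = PAdd (psubst s p) (psubst s q)"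
| "psubst s (PMul p q) = PMul (psubst s p) (psubst s q)"

definition nonzero :: "pexp \<Rightarrow> bool" where
  "nonzero p \<longleftrightarrow> (\<exists>x. peval p x \<noteq> 0)"

text \<open>The first \<open>n\<close> values of \<open>t\<close> are algebraically independent over
  the rationals. Nonvanishing as a function and as a polynomial agree, the reals being
  infinite.\<close>

definition generic :: "nat \<Rightarrow> (nat \<Rightarrow> real) \<Rightarrow> bool" where
  "generic n t \<longleftrightarrow> (\<forall>p. pvars p \<subseteq> {..<n} \<longrightarrow> nonzero p \<longrightarrow> peval p t \<noteq> 0)"

lemma peval_psubst: "peval (psubst s p) x = peval p (\<lambda>i. peval (s i) x)"
  by (induction p) auto

lemma pvars_psubst: "pvars (psubst s p) = (\<Union>i\<in>pvars p. pvars (s i))"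
  by (induction p) auto

lemma peval_cong: "(\<And>i. i \<in> pvars p \<Longrightarrow> x i = y i) \<Longrightarrow> peval p x = peval p y"
  by (induction p) auto

lemma peval_upd_poly:
  "\<exists>q. Polynomial.degree q \<le> pdeg p \<and> (\<forall>z. peval p (x(i := z)) = poly q z)"
proof (induction p)
  case (PConst c)
  show ?case by (intro exI[of _ "[:of_rat c:]"]) auto
next
  case (PVar j)
  show ?case
    by (cases "i = j") (auto intro: exI[of _ "[:0, 1:]"] exI[of _ "[:x j:]"])
next
  case (PAdd p1 p2)
  then obtain q1 q2 where "Polynomial.degree q1 \<le> pdeg p1" "\<forall>z. peval p1 (x(i := z)) = poly q1 z"
    "Polynomial.degree q2 \<le> pdeg p2" "\<forall>z. peval p2 (x(i := z)) = poly q2 z" by blast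
  then have "Polynomial.degree (q1 + q2) \<le> pdeg (PAdd p1 p2)"
    "\<forall>z. peval (PAdd p1 p2) (x(i := z)) = poly (q1 + q2) z"
    by (simp_all only: peval.simps pdeg.simps poly_add)
      (auto intro: order.trans[OF Polynomial.degree_add_le_max] max.mono)
  then show ?case by blast
next
  case (PMul p1 p2)
  then obtain q1 q2 where "Polynomial.degree q1 \<le> pdeg p1" "\<forall>z. peval p1 (x(i := z)) = poly q1 z"
    "Polynomial.degree q2 \<le> pdeg p2" "\<forall>z. peval p2 (x(i := z)) = poly q2 z" by blast
  then have "Polynomial.degree (q1 * q2) \<le> pdeg (PMul p1 p2)"
    "\<forall>z. peval (PMul p1 p2) (x(i := z)) = poly (q1 * q2) z"
    by (simp_all only: peval.simps pdeg.simps poly_mult)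
      (auto intro: order.trans[OF Polynomial.degree_mult_le] add_mono)
  then show ?case by blast
qed

lemma generic_last_variable:
  assumes t: "generic m t" and p: "pvars p \<subseteq> {..m}" "nonzero p"
  obtains q where "q \<noteq> 0" "Polynomial.degree q \<le> pdeg p" "\<And>z. peval p (t(m := z)) = poly q z"
proof -
  obtain x where x: "peval p x \<noteq> 0" using p(2) by (auto simp: nonzero_def)
  obtain r where r: "\<forall>z. peval p (x(m := z)) = poly r z"
    using peval_upd_poly[of p x m] by blast
  have "poly r (x m) \<noteq> 0" using x r[rule_format, of "x m"] by simp
  then have "finite {z. poly r z = 0}" using poly_roots_finite[of r] by fastforce
  moreover have "infinite (range (of_int :: int \<Rightarrow> real))"
    by (simp add: finite_image_iff inj_on_def infinite_UNIV_int)
  \<comment> \<open>The value of the last variable is taken to be an integer, so that it can be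
    substituted as a rational constant. This yields an expression in the first \<open>m\<close>
    variables alone, to which genericity of \<open>t\<close> applies.\<close>
  ultimately obtain k :: int where k: "poly r (of_int k) \<noteq> 0"
    by (metis (mono_tags, lifting) finite_subset image_subsetI mem_Collect_eq)
  define p' where "p' = psubst (\<lambda>i. if i = m then PConst (of_int k) else PVar i) p"
  have ev: "peval p' y = peval p (y(m := of_int k))" for y
    unfolding p'_def peval_psubst by (rule peval_cong) auto
  have "pvars p' \<subseteq> {..<m}" using p(1) by (auto simp: p'_def pvars_psubst split: if_splits)
  moreover have "nonzero p'" using ev[of x] k r unfolding nonzero_def by metis
  ultimately have nz: "peval p (t(m := of_int k)) \<noteq> 0" using t ev[of t] by (auto simp: generic_def)
  obtain q where q: "Polynomial.degree q \<le> pdeg p" "\<forall>z. peval p (t(m := z)) = poly q z"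
    using peval_upd_poly[of p t m] by blast
  then have "q \<noteq> 0" using nz by auto
  then show thesis using that q by blast
qed

lemma generic_0: "generic 0 t"
  unfolding generic_def
proof (intro allI impI)
  fix p assume p: "pvars p \<subseteq> {..<0}" "nonzero p"
  then obtain x where "peval p x \<noteq> 0" by (auto simp: nonzero_def)
  moreover have "peval p x = peval p t" using p by (intro peval_cong) auto
  ultimately show "peval p t \<noteq> 0" by simp
qed

text \<open>One coordinate is added at a time. Each of the countably many nonzero expressions
  excludes only finitely many values of the new coordinate, and the reals are uncountable.\<close>

lemma generic_exists: "\<exists>t. generic n t"
proof (induction n)
  case 0
  show ?case using generic_0 by blast
next
  case (Suc n)
  then obtain t where t: "generic n t" by blast
  define P where "P = {p. pvars p \<subseteq> {..n} \<and> nonzero p}"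
  have "finite {z. peval p (t(n := z)) = 0}" if "p \<in> P" for p
  proof -
    have "pvars p \<subseteq> {..n}" "nonzero p" using \<open>p \<in> P\<close> by (auto simp: P_def)
    then obtain q where "q \<noteq> 0" "\<And>z. peval p (t(n := z)) = poly q z"
      by (rule generic_last_variable[OF t]) metis
    then show ?thesis using poly_roots_finite by auto
  qed
  then have "countable (\<Union>p\<in>P. {z. peval p (t(n := z)) = 0})"
    by (intro countable_UN) (auto intro: countable_finite)
  then have "(\<Union>p\<in>P. {z. peval p (t(n := z)) = 0}) \<noteq> UNIV"
    using uncountable_UNIV_real by auto
  then obtain z where "\<forall>p\<in>P. peval p (t(n := z)) \<noteq> 0" by auto
  then have "generic (Suc n) (t(n := z))"
    by (auto simp: generic_def P_def lessThan_Suc_atMost)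
  then show ?case by blast
qed

section \<open>Counting monomials over the rationals\<close>

interpretation ratvs: vector_space "\<lambda>(c::rat) (x::real). of_rat c * x"
  by unfold_locales (auto simp: algebra_simps of_rat_add of_rat_mult)

text \<open>Dependence is stated for an indexed family because values at distinct indices may
  coincide; such a coincidence is already a nontrivial relation.\<close>

lemma (in vector_space) dependent_family:
  assumes "finite I" "finite S" "card S < card I" "v ` I \<subseteq> span S"
  shows "\<exists>c. (\<exists>i\<in>I. c i \<noteq> 0) \<and> (\<Sum>i\<in>I. scale (c i) (v i)) = 0"
proof (cases "inj_on v I")
  case True
  then have "card (v ` I) = card I" by (rule card_image)
  then have "dependent (v ` I)"
    using independent_span_bound[of S "v ` I"] assms by auto
  then obtain u where u: "\<exists>x\<in>v ` I. u x \<noteq> 0" "(\<Sum>x\<in>v ` I. scale (u x) x) = 0"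
    using dependent_finite[of "v ` I"] assms(1) by auto
  have "(\<Sum>i\<in>I. scale (u (v i)) (v i)) = 0"
    using u(2) sum.reindex[OF True, of "\<lambda>x. scale (u x) x"] by simp
  then show ?thesis using u(1) by (intro exI[of _ "u \<circ> v"]) auto
next
  case False
  then obtain i j where ij: "i \<in> I" "j \<in> I" "i \<noteq> j" "v i = v j" by (auto simp: inj_on_def)
  define c where "c = (\<lambda>k. if k = i then 1 else if k = j then -1 else 0 :: 'a)"
  have "(\<Sum>k\<in>I. scale (c k) (v k)) = (\<Sum>k\<in>{i, j}. scale (c k) (v k))"
    using assms(1) ij by (intro sum.mono_neutral_right) (auto simp: c_def)
  also have "\<dots> = 0" using ij by (simp add: c_def)
  finally show ?thesis using ij by (intro exI[of _ c]) (auto simp: c_def)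
qed

text \<open>The bound \<open>d\<close> limits each exponent separately, not the total degree, so the
  number of monomials is at most a plain power of \<open>Suc d\<close>.\<close>

definition monomials :: "nat \<Rightarrow> (nat \<Rightarrow> real) \<Rightarrow> nat \<Rightarrow> real set" where
  "monomials n t d = (\<lambda>e. \<Prod>i<n. t i ^ e i) ` ({..<n} \<rightarrow>\<^sub>E {..d})"

lemma finite_monomials: "finite (monomials n t d)"
  and card_monomials_le: "card (monomials n t d) \<le> Suc d ^ n"
proof -
  have fin: "finite ({..<n} \<rightarrow>\<^sub>E {..d})" by (intro finite_PiE) auto
  then show "finite (monomials n t d)" by (simp add: monomials_def)
  show "card (monomials n t d) \<le> Suc d ^ n"
    unfolding monomials_def using card_image_le[OF fin] by (simp add: card_PiE)
qed

lemma monomials_mono: "d \<le> d' \<Longrightarrow> monomials n t d \<subseteq> monomials n t d'"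
  unfolding monomials_def by (intro image_mono PiE_mono) auto

lemma monomials_mult:
  assumes "x \<in> monomials n t d" "y \<in> monomials n t d'" shows "x * y \<in> monomials n t (d + d')"
proof -
  obtain e f where e: "e \<in> {..<n} \<rightarrow>\<^sub>E {..d}" "x = (\<Prod>i<n. t i ^ e i)"
    and f: "f \<in> {..<n} \<rightarrow>\<^sub>E {..d'}" "y = (\<Prod>i<n. t i ^ f i)"
    using assms by (auto simp: monomials_def)
  have "x * y = (\<Prod>i<n. t i ^ restrict (\<lambda>i. e i + f i) {..<n} i)"
    by (simp add: e f prod.distrib[symmetric] power_add)
  moreover have "restrict (\<lambda>i. e i + f i) {..<n} \<in> {..<n} \<rightarrow>\<^sub>E {..d + d'}"
    using e(1) f(1) by (auto intro!: add_mono)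
  ultimately show ?thesis unfolding monomials_def by blast
qed

lemma span_monomials_mult:
  assumes x: "x \<in> ratvs.span (monomials n t d)" and y: "y \<in> ratvs.span (monomials n t d')"
  shows "x * y \<in> ratvs.span (monomials n t (d + d'))"
proof -
  let ?S = "ratvs.span (monomials n t (d + d'))"
  have sub: "ratvs.subspace {x. x * y \<in> ?S}" for y
  proof (rule ratvs.subspaceI)
    show "of_rat c * x \<in> {x. x * y \<in> ?S}" if "x \<in> {x. x * y \<in> ?S}" for c x
      using that ratvs.span_scale[of "x * y" _ c] by (simp add: mult.assoc)
  qed (auto simp: distrib_right intro: ratvs.span_add ratvs.span_zero)
  have sub': "ratvs.subspace {y. x * y \<in> ?S}"
    using sub[of x] by (simp only: mult.commute[of _ x])
  have 1: "x * y \<in> ?S" if "y \<in> monomials n t d'" for y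
    using x sub by (rule ratvs.span_induct) (auto intro: ratvs.span_base monomials_mult that)
  show ?thesis
    using y sub' by (rule ratvs.span_induct) (rule 1)
qed

lemma peval_in_span:
  assumes "pvars p \<subseteq> {..<n}"
  shows "peval p t \<in> ratvs.span (monomials n t (pdeg p))"
  using assms
proof (induction p)
  case (PConst c)
  have "1 \<in> monomials n t 0"
    unfolding monomials_def by (rule image_eqI[of _ _ "restrict (\<lambda>_. 0) {..<n}"]) auto
  then have "of_rat c * 1 \<in> ratvs.span (monomials n t 0)"
    by (intro ratvs.span_scale ratvs.span_base)
  then show ?case by simp
next
  case (PVar i)
  have "t i = (\<Prod>j<n. t j ^ restrict (\<lambda>j. if j = i then 1 else 0) {..<n} j)"
  proof -
    have "(\<Prod>j<n. t j ^ restrict (\<lambda>j. if j = i then 1 else 0) {..<n} j)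
        = (\<Prod>j<n. if j = i then t j else 1)"
      by (rule prod.cong) auto
    also have "\<dots> = t i" using PVar by (simp add: prod.delta)
    finally show ?thesis by simp
  qed
  then have "t i \<in> monomials n t 1"
    unfolding monomials_def by (intro image_eqI[of _ _ "restrict (\<lambda>j. if j = i then 1 else 0) {..<n}"]) auto
  then show ?case by (auto intro: ratvs.span_base)
next
  case (PAdd p q)
  have "ratvs.span (monomials n t (pdeg p)) \<subseteq> ratvs.span (monomials n t (pdeg (PAdd p q)))"
    "ratvs.span (monomials n t (pdeg q)) \<subseteq> ratvs.span (monomials n t (pdeg (PAdd p q)))"
    by (intro ratvs.span_mono monomials_mono; simp)+
  then show ?case using PAdd by (auto intro!: ratvs.span_add)
next
  case (PMul p q)
  then show ?case by (auto intro!: span_monomials_mult)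
qed

definition digit :: "nat \<Rightarrow> nat \<Rightarrow> nat \<Rightarrow> nat" where
  "digit b j k = k div b ^ j mod b"

lemma sum_digits:
  shows "(\<Sum>j<n. digit b j k * b ^ j) = k mod b ^ n"
proof (induction n)
  case (Suc n)
  have "k mod b ^ Suc n = b ^ n * (k div b ^ n mod b) + k mod b ^ n"
    using mod_mult2_eq[of k "b ^ n" b] by (simp add: mult.commute)
  then show ?case using Suc by (simp add: digit_def)
qed simp

lemma pexp_sum:
  assumes "finite I" "\<And>i. i \<in> I \<Longrightarrow> \<exists>p. pvars p \<subseteq> V \<and> (\<forall>x. peval p x = F i x)"
  shows "\<exists>p. pvars p \<subseteq> V \<and> (\<forall>x. peval p x = (\<Sum>i\<in>I. F i x))"
  using assms
proof (induction I rule: finite_induct)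
  case empty
  show ?case by (intro exI[of _ "PConst 0"]) auto
next
  case (insert i I)
  then obtain p q where "pvars p \<subseteq> V" "\<forall>x. peval p x = F i x"
    "pvars q \<subseteq> V" "\<forall>x. peval q x = (\<Sum>i\<in>I. F i x)" by (metis insertCI)
  then show ?case using insert.hyps by (intro exI[of _ "PAdd p q"]) auto
qed

lemma pexp_prod:
  assumes "finite I" "\<And>i. i \<in> I \<Longrightarrow> \<exists>p. pvars p \<subseteq> V \<and> (\<forall>x. peval p x = F i x)"
  shows "\<exists>p. pvars p \<subseteq> V \<and> (\<forall>x. peval p x = (\<Prod>i\<in>I. F i x))"
  using assms
proof (induction I rule: finite_induct)
  case empty
  show ?case by (intro exI[of _ "PConst 1"]) auto
next
  case (insert i I)
  then obtain p q where "pvars p \<subseteq> V" "\<forall>x. peval p x = F i x"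
    "pvars q \<subseteq> V" "\<forall>x. peval q x = (\<Prod>i\<in>I. F i x)" by (metis insertCI)
  then show ?case using insert.hyps by (intro exI[of _ "PMul p q"]) auto
qed

text \<open>The coefficient family is recovered by the Kronecker substitution
  \<open>x\<^sub>j = z ^ (b ^ j)\<close>, which maps the monomial with exponents the base-\<open>b\<close> digits of \<open>k\<close> to \<open>z ^ k\<close>.\<close>

lemma nonzero_digit_combination:
  assumes "\<exists>k<b ^ n. c k \<noteq> (0::rat)"
  obtains p where "pvars p \<subseteq> {..<n}" "nonzero p"
    "\<forall>x. peval p x = (\<Sum>k<b ^ n. of_rat (c k) * (\<Prod>j<n. x j ^ digit b j k))"
proof -
  have "\<exists>p. pvars p \<subseteq> {..<n} \<and> (\<forall>x. peval p x = of_rat (c k) * (\<Prod>j<n. x j ^ digit b j k))" for k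
  proof -
    have "\<exists>p. pvars p \<subseteq> {..<n} \<and> (\<forall>x. peval p x = x j ^ e)" if "j < n" for j e
    proof -
      have "\<exists>p. pvars p \<subseteq> {..<n} \<and> (\<forall>x. peval p x = x j)"
        using that by (intro exI[of _ "PVar j"]) auto
      then show ?thesis
        using pexp_prod[of "{..<e}" "{..<n}" "\<lambda>_ x. x j"] by simp
    qed
    then obtain p where "pvars p \<subseteq> {..<n}" "\<forall>x. peval p x = (\<Prod>j<n. x j ^ digit b j k)"
      using pexp_prod[of "{..<n}" "{..<n}" "\<lambda>j x. x j ^ digit b j k"] by auto
    then show ?thesis by (intro exI[of _ "PMul (PConst (c k)) p"]) auto
  qed
  then obtain p where p: "pvars p \<subseteq> {..<n}"
    "\<forall>x. peval p x = (\<Sum>k<b ^ n. of_rat (c k) * (\<Prod>j<n. x j ^ digit b j k))"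
    using pexp_sum[of "{..<b ^ n}" "{..<n}" "\<lambda>k x. of_rat (c k) * (\<Prod>j<n. x j ^ digit b j k)"] by auto
  define q where "q = (\<Sum>k<b ^ n. Polynomial.monom (of_rat (c k) :: real) k)"
  have "peval p (\<lambda>j. z ^ (b ^ j)) = poly q z" for z
  proof -
    have "(\<Prod>j<n. (z ^ (b ^ j)) ^ digit b j k) = z ^ k" if "k < b ^ n" for k
    proof -
      have "(\<Prod>j<n. (z ^ (b ^ j)) ^ digit b j k) = z ^ (\<Sum>j<n. digit b j k * b ^ j)"
        by (simp add: power_mult[symmetric] power_sum mult.commute)
      then show ?thesis using that by (simp add: sum_digits)
    qed
    then show ?thesis using p(2) by (simp add: q_def poly_sum poly_monom)
  qed
  moreover have "q \<noteq> 0"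
  proof -
    obtain k where k: "k < b ^ n" "c k \<noteq> 0" using assms by blast
    have "Polynomial.coeff q k = of_rat (c k)"
      using k(1) by (simp add: q_def Polynomial.coeff_sum)
    then show ?thesis using k(2) by auto
  qed
  ultimately have "nonzero p" using poly_all_0_iff_0[of q] unfolding nonzero_def by metis
  then show thesis using that p by blast
qed

text \<open>Products of powers of n + 1 polynomials in n variables outnumber, for large exponents,
  the monomials that span them. The relation is wanted only at the given \<open>t\<close>, so the
  count takes place among real numbers.\<close>

lemma algebraic_dependence:
  assumes f: "\<And>j. j \<le> n \<Longrightarrow> pvars (f j) \<subseteq> {..<n}"
  obtains p where "pvars p \<subseteq> {..n}" "nonzero p" "peval p (\<lambda>j. peval (f j) t) = 0"
proof -
  define d where "d = (\<Sum>j\<le>n. pdeg (f j))"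
  \<comment> \<open>Exponents below \<open>b\<close> give b^(n+1) products, whose monomials have
    exponents at most (n+1)bd. There are at most ((n+1)bd + 1)^n such monomials, which is at most
    ((n+1)d + 1)^n b^n. Taking \<open>b\<close> larger than ((n+1)d + 1)^n makes this less than
    b^(n+1).\<close>
  define b where "b = Suc (Suc (Suc n * d) ^ n)"
  define v where "v = (\<lambda>k. \<Prod>j<Suc n. peval (f j) t ^ digit b j k)"
  have pw: "x ^ e \<in> ratvs.span (monomials n t (e * D))" if "x \<in> ratvs.span (monomials n t D)" for x e D
  proof (induction e)
    case 0
    then show ?case using peval_in_span[of "PConst 1" n t] by simp
  next
    case (Suc e)
    then show ?case using span_monomials_mult[OF that Suc] by simp
  qed
  have pr: "(\<Prod>j<m. peval (f j) t ^ digit b j k) \<in> ratvs.span (monomials n t (m * (b * d)))"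
    if "m \<le> Suc n" for m k
    using that
  proof (induction m)
    case 0
    then show ?case using peval_in_span[of "PConst 1" n t] by simp
  next
    case (Suc m)
    have "pdeg (f m) \<le> d" using Suc.prems unfolding d_def by (intro member_le_sum) auto
    then have "ratvs.span (monomials n t (pdeg (f m))) \<subseteq> ratvs.span (monomials n t d)"
      by (intro ratvs.span_mono monomials_mono)
    then have "peval (f m) t \<in> ratvs.span (monomials n t d)"
      using peval_in_span[OF f, of m t] Suc.prems by auto
    then have "peval (f m) t ^ digit b m k \<in> ratvs.span (monomials n t (digit b m k * d))"
      by (rule pw)
    moreover have "digit b m k < b" by (simp add: digit_def b_def)
    then have "digit b m k * d \<le> b * d" by simp
    then have "ratvs.span (monomials n t (digit b m k * d)) \<subseteq> ratvs.span (monomials n t (b * d))"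
      by (intro ratvs.span_mono monomials_mono)
    ultimately have "peval (f m) t ^ digit b m k \<in> ratvs.span (monomials n t (b * d))" by blast
    from span_monomials_mult[OF Suc.IH this] Suc.prems show ?case by (simp add: algebra_simps)
  qed
  have "card (monomials n t (Suc n * (b * d))) \<le> Suc (Suc n * (b * d)) ^ n"
    by (rule card_monomials_le)
  also have "\<dots> \<le> (Suc (Suc n * d) * b) ^ n"
    by (intro power_mono) (auto simp: b_def algebra_simps)
  also have "\<dots> = Suc (Suc n * d) ^ n * b ^ n" by (rule power_mult_distrib)
  also have "\<dots> < b * b ^ n" by (simp add: b_def)
  finally have "card (monomials n t (Suc n * (b * d))) < card {..<b ^ Suc n}" by simp
  moreover have "v ` {..<b ^ Suc n} \<subseteq> ratvs.span (monomials n t (Suc n * (b * d)))"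
    unfolding v_def using pr[of "Suc n"] by blast
  ultimately obtain c where c: "\<exists>k\<in>{..<b ^ Suc n}. c k \<noteq> 0" "(\<Sum>k<b ^ Suc n. of_rat (c k) * v k) = 0"
    using ratvs.dependent_family[of "{..<b ^ Suc n}" "monomials n t (Suc n * (b * d))" v] finite_monomials
    by blast
  have "\<exists>k<b ^ Suc n. c k \<noteq> 0" using c(1) by blast
  then obtain p where p: "pvars p \<subseteq> {..<Suc n}" "nonzero p"
    "\<forall>x. peval p x = (\<Sum>k<b ^ Suc n. of_rat (c k) * (\<Prod>j<Suc n. x j ^ digit b j k))"
    by (rule nonzero_digit_combination)
  show thesis
    using that[of p] p c(2) by (simp add: v_def lessThan_Suc_atMost)
qed

text \<open>The entries of \<open>val S\<close> are the coordinates of the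
  elements of \<open>S\<close>; polynomial relations persist when \<open>S\<close> grows, and the transcendence degree is
  bounded. A maximal tuple of coordinates that stays algebraically independent for every \<open>S\<close> makes all
  other coordinates algebraic over it.\<close>

lemma countable_if_transcendence_bounded:
  fixes K :: "'a set" and val :: "'a set \<Rightarrow> 'a \<times> nat \<Rightarrow> real"
  assumes spec: "\<And>S S' p \<sigma>. finite S' \<Longrightarrow> S \<subseteq> S' \<Longrightarrow> S' \<subseteq> K \<Longrightarrow>
      (\<And>i. i \<in> pvars p \<Longrightarrow> \<sigma> i \<in> S \<times> {..<4}) \<Longrightarrow>
      peval p (\<lambda>i. val S (\<sigma> i)) = 0 \<Longrightarrow> peval p (\<lambda>i. val S' (\<sigma> i)) = 0"
    and dim: "\<And>S \<sigma>. finite S \<Longrightarrow> S \<subseteq> K \<Longrightarrow> (\<And>i. i \<le> N \<Longrightarrow> \<sigma> i \<in> S \<times> {..<4}) \<Longrightarrow>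
      \<exists>p. pvars p \<subseteq> {..N} \<and> nonzero p \<and> peval p (\<lambda>i. val S (\<sigma> i)) = 0"
    and inj: "\<And>S g h. finite S \<Longrightarrow> S \<subseteq> K \<Longrightarrow> g \<in> S \<Longrightarrow> h \<in> S \<Longrightarrow>
      (\<And>k. k < 4 \<Longrightarrow> val S (g, k) = val S (h, k)) \<Longrightarrow> g = h"
  shows "countable K"
proof -
  \<comment> \<open>Enlarging \<open>S\<close> can create new relations but never destroys old ones.
    Independence is therefore demanded for all finite \<open>S\<close> that contain the elements
    involved.\<close>
  define indep where "indep = (\<lambda>m \<sigma>. (\<forall>i<m. \<sigma> i \<in> K \<times> {..<4::nat}) \<and>
    (\<forall>S. finite S \<and> S \<subseteq> K \<and> (\<forall>i<m. fst (\<sigma> i) \<in> S) \<longrightarrow> generic m (\<lambda>i. val S (\<sigma> i))))"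
  have bound: "m \<le> N" if "indep m \<sigma>" for m \<sigma>
  proof (rule ccontr)
    assume "\<not> m \<le> N"
    define S where "S = (\<lambda>i. fst (\<sigma> i)) ` {..<m}"
    have \<sigma>: "\<sigma> i \<in> K \<times> {..<4}" if "i < m" for i using \<open>indep m \<sigma>\<close> that by (simp add: indep_def)
    have S: "finite S" "S \<subseteq> K" "\<And>i. i < m \<Longrightarrow> fst (\<sigma> i) \<in> S"
      using \<sigma> by (auto simp: S_def mem_Times_iff)
    then have "generic m (\<lambda>i. val S (\<sigma> i))" using that by (simp add: indep_def)
    moreover obtain p where "pvars p \<subseteq> {..N}" "nonzero p" "peval p (\<lambda>i. val S (\<sigma> i)) = 0"
      using dim[of S \<sigma>] S \<sigma> \<open>\<not> m \<le> N\<close> by (auto simp: mem_Times_iff)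
    moreover have "{..N} \<subseteq> {..<m}" using \<open>\<not> m \<le> N\<close> by auto
    ultimately show False by (auto simp: generic_def)
  qed
  define m where "m = (GREATEST m. \<exists>\<sigma>. indep m \<sigma>)"
  have "indep 0 \<sigma>" for \<sigma> by (simp add: indep_def generic_0)
  then have ex: "\<exists>\<sigma>. indep m \<sigma>"
    unfolding m_def using bound GreatestI_nat[of "\<lambda>m. \<exists>\<sigma>. indep m \<sigma>" 0 N] by blast
  have max: "\<not> indep (Suc m) \<sigma>" for \<sigma>
  proof
    assume "indep (Suc m) \<sigma>"
    then have "Suc m \<le> m"
      unfolding m_def using bound Greatest_le_nat[of "\<lambda>m. \<exists>\<sigma>. indep m \<sigma>" _ N] by blast
    then show False by simp
  qed
  obtain \<sigma> where \<sigma>: "indep m \<sigma>" using ex by blast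
  have \<sigma>K: "\<sigma> i \<in> K \<times> {..<4}" if "i < m" for i using \<sigma> that by (simp add: indep_def)
  \<comment> \<open>Appending any coordinate to the maximal tuple produces a relation at some finite
    stage.\<close>
  have "\<exists>S p. finite S \<and> S \<subseteq> K \<and> g \<in> S \<and> (\<forall>i<m. fst (\<sigma> i) \<in> S) \<and> pvars p \<subseteq> {..m} \<and> nonzero p \<and>
      peval p (\<lambda>i. val S ((\<sigma>(m := (g, k))) i)) = 0" if "g \<in> K" "k < 4" for g k
  proof -
    have "\<forall>i<Suc m. (\<sigma>(m := (g, k))) i \<in> K \<times> {..<4}" using that \<sigma>K by (auto simp: less_Suc_eq)
    then obtain S where S: "finite S" "S \<subseteq> K" "\<forall>i<Suc m. fst ((\<sigma>(m := (g, k))) i) \<in> S"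
      "\<not> generic (Suc m) (\<lambda>i. val S ((\<sigma>(m := (g, k))) i))"
      using max[of "\<sigma>(m := (g, k))"] unfolding indep_def by blast
    then obtain p where "pvars p \<subseteq> {..<Suc m}" "nonzero p" "peval p (\<lambda>i. val S ((\<sigma>(m := (g, k))) i)) = 0"
      unfolding generic_def by blast
    moreover have "g \<in> S" using S(3)[rule_format, of m] by simp
    moreover have "fst (\<sigma> i) \<in> S" if "i < m" for i using S(3)[rule_format, of i] that by simp
    ultimately show ?thesis using S(1,2) by (auto simp: lessThan_Suc_atMost)
  qed
  then obtain Sf pf where f: "\<And>g k. g \<in> K \<Longrightarrow> k < 4 \<Longrightarrow> finite (Sf g k) \<and> Sf g k \<subseteq> K \<and> g \<in> Sf g k \<and>
      (\<forall>i<m. fst (\<sigma> i) \<in> Sf g k) \<and> pvars (pf g k) \<subseteq> {..m} \<and> nonzero (pf g k) \<and>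
      peval (pf g k) (\<lambda>i. val (Sf g k) ((\<sigma>(m := (g, k))) i)) = 0"
    by metis
  \<comment> \<open>Elements are classified by the four expressions attached to their coordinates.
    There are countably many lists of expressions, so finiteness of each class suffices.\<close>
  define fib where "fib = (\<lambda>L. {g \<in> K. \<forall>k<4. pf g k = L ! k})"
  have "finite (fib L)" for L
  proof -
    have "card T \<le> (\<Prod>k<4. pdeg (L ! k))" if T: "T \<subseteq> fib L" "finite T" for T
    proof (cases "T = {}")
      case False
      then obtain g0 where g0: "g0 \<in> T" by blast
      have TK: "T \<subseteq> K" using T by (auto simp: fib_def)
      have pf: "pf g k = L ! k" if "g \<in> T" "k < 4" for g k using T that by (auto simp: fib_def)
      \<comment> \<open>One common stage contains all the stages at which the relations for elements
        of \<open>T\<close> arose, so all these relations hold there simultaneously. The elements of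
        \<open>T\<close> share the four expressions and the generic values \<open>t\<close>, hence
        their coordinates are roots of the same four nonzero polynomials in one variable.\<close>
      define S where "S = T \<union> (\<lambda>i. fst (\<sigma> i)) ` {..<m} \<union> (\<Union>g\<in>T. \<Union>k<4. Sf g k)"
      have Sf: "Sf g k \<subseteq> K" "finite (Sf g k)" if "g \<in> T" "k < 4" for g k
        using f[of g k] TK that by auto
      have S: "finite S" using Sf(2) T(2) by (auto simp: S_def)
      have SK: "S \<subseteq> K" using Sf(1) TK \<sigma>K by (fastforce simp: S_def mem_Times_iff)
      define t where "t = (\<lambda>i. val S (\<sigma> i))"
      have gen: "generic m t" using \<sigma> S SK by (auto simp: indep_def t_def S_def)
      have "\<exists>q. q \<noteq> 0 \<and> Polynomial.degree q \<le> pdeg (L ! k) \<and> (\<forall>z. peval (L ! k) (t(m := z)) = poly q z)"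
        if "k < 4" for k
      proof -
        have "pvars (L ! k) \<subseteq> {..m}" "nonzero (L ! k)"
          using f[of g0 k] g0 TK pf[OF g0] that by auto
        then show ?thesis by (metis generic_last_variable[OF gen])
      qed
      then obtain q where q: "\<And>k. k < 4 \<Longrightarrow> q k \<noteq> 0 \<and> Polynomial.degree (q k) \<le> pdeg (L ! k) \<and>
          (\<forall>z. peval (L ! k) (t(m := z)) = poly (q k) z)" by metis
      define R where "R = (\<lambda>k. {z. poly (q k) z = 0})"
      have R: "finite (R k)" "card (R k) \<le> pdeg (L ! k)" if "k < 4" for k
        using q[OF that] poly_roots_finite[of "q k"] card_poly_roots_bound[of "q k"]
        by (auto simp: R_def)
      have root: "val S (g, k) \<in> R k" if gk: "g \<in> T" "k < 4" for g k
      proof -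
        have "g \<in> K" using gk TK by blast
        note fgk = f[OF this gk(2)]
        have "peval (pf g k) (\<lambda>i. val S ((\<sigma>(m := (g, k))) i)) = 0"
        proof (rule spec[of S "Sf g k"])
          show "Sf g k \<subseteq> S" using gk by (auto simp: S_def)
          show "(\<sigma>(m := (g, k))) i \<in> Sf g k \<times> {..<4}" if "i \<in> pvars (pf g k)" for i
            using that fgk gk \<sigma>K[of i] by (cases "i = m") (auto simp: mem_Times_iff)
        qed (use S SK fgk in auto)
        moreover have "(\<lambda>i. val S ((\<sigma>(m := (g, k))) i)) = t(m := val S (g, k))"
          by (auto simp: t_def)
        ultimately have "poly (q k) (val S (g, k)) = 0" using q[OF gk(2)] pf[OF gk] by simp
        then show ?thesis by (simp add: R_def)
      qed
      let ?\<phi> = "\<lambda>g. restrict (\<lambda>k. val S (g, k)) {..<4}"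
      have "inj_on ?\<phi> T"
      proof (rule inj_onI)
        fix g h assume gh: "g \<in> T" "h \<in> T" and eq: "?\<phi> g = ?\<phi> h"
        have "val S (g, k) = val S (h, k)" if "k < 4" for k using fun_cong[OF eq, of k] that by simp
        then show "g = h" using gh by (intro inj[OF S SK]) (auto simp: S_def)
      qed
      moreover have "?\<phi> ` T \<subseteq> (\<Pi>\<^sub>E k\<in>{..<4}. R k)" using root by (auto intro!: restrict_PiE_iff[THEN iffD2])
      moreover have "finite (\<Pi>\<^sub>E k\<in>{..<4}. R k)" using R(1) by (intro finite_PiE) auto
      ultimately have "card T \<le> card (\<Pi>\<^sub>E k\<in>{..<4}. R k)" by (rule card_inj_on_le)
      also have "\<dots> = (\<Prod>k<4. card (R k))" by (simp add: card_PiE)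
      also have "\<dots> \<le> (\<Prod>k<4. pdeg (L ! k))" using R(2) by (intro prod_mono) auto
      finally show ?thesis .
    qed simp
    then show ?thesis using finite_if_finite_subsets_card_bdd by blast
  qed
  then have "countable (\<Union>L. fib L)" by (intro countable_UN) (auto intro: countable_finite)
  moreover have "K \<subseteq> (\<Union>L. fib L)"
  proof
    fix g assume "g \<in> K"
    then have "g \<in> fib (map (pf g) [0..<4])" by (auto simp: fib_def)
    then show "g \<in> (\<Union>L. fib L)" by blast
  qed
  ultimately show ?thesis by (rule countable_subset[rotated])
qed

section \<open>Generic representations\<close>

text \<open>Every element of SL2 over a field is a product of four elementary matrices
  (upper, lower, upper, lower), so SL2 is a polynomial image of affine 4-space.\<close>

definition SL2_param :: "(nat \<Rightarrow> real) \<Rightarrow> real \<times> real \<times> real \<times> real" where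
  "SL2_param y = ((1 + y 0 * y 1) * (1 + y 2 * y 3) + y 0 * y 3, (1 + y 0 * y 1) * y 2 + y 0,
     y 1 * (1 + y 2 * y 3) + y 3, y 1 * y 2 + 1)"

lemma SL2_param_carrier: "SL2_param y \<in> carrier SL2"
  by (simp add: SL2_param_def SL2_carrier algebra_simps)

lemma SL2_param_surj:
  assumes "M \<in> carrier SL2"
  obtains y where "SL2_param y = M"
proof -
  obtain a b c d where M: "M = (a, b, c, d)" "a * d - b * c = 1"
    using assms by (cases M) (auto simp: SL2_carrier)
  show thesis
  proof (cases "c = 0")
    case False
    \<comment> \<open>For nonzero c three elementary factors are enough, so the last parameter is
      0.\<close>
    define y where "y = (\<lambda>k::nat. if k = 0 then (a - 1) / c else if k = 1 then c
      else if k = 2 then (d - 1) / c else 0)"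
    have "c * (a * d) = c * (1 + b * c)" using M(2) by simp
    then have "a * (c * d) = c + b * (c * c)" by (simp add: algebra_simps)
    then have "SL2_param y = M"
      using False by (simp add: SL2_param_def M(1) y_def field_simps)
    then show thesis by (rule that)
  next
    case True
    then have ad: "a * d = 1" using M(2) by simp
    then have d: "d \<noteq> 0" by auto
    \<comment> \<open>When c = 0, right multiplication by the lower elementary matrix with entry -1
      gives first column (a - b, -d) with -d nonzero. The three-factor formula applies to that
      matrix, and the last parameter 1 undoes the multiplication.\<close>
    define y where "y = (\<lambda>k::nat. if k = 0 then (a - b - 1) / (- d) else if k = 1 then - d
      else if k = 2 then (d - 1) / (- d) else 1)"
    have a: "a = 1 / d" using ad d by (simp add: field_simps)
    have "SL2_param y = M"
      using d by (simp add: SL2_param_def M(1) y_def True a field_simps)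
    then show thesis by (rule that)
  qed
qed

definition entry :: "nat \<Rightarrow> real \<times> real \<times> real \<times> real \<Rightarrow> real" where
  "entry k = (\<lambda>(a, b, c, d). [a, b, c, d] ! k)"

lemma eq_by_entries: "(\<And>k. k < 4 \<Longrightarrow> entry k M = entry k N) \<Longrightarrow> M = N"
proof -
  assume e: "\<And>k. k < 4 \<Longrightarrow> entry k M = entry k N"
  show "M = N"
    using e[of 0] e[of 1] e[of 2] e[of 3]
    by (cases M; cases N) (simp add: entry_def numeral_2_eq_2 numeral_3_eq_3)
qed

section \<open>Matrices with polynomial entries\<close>

definition polynomial_matrix :: "nat set \<Rightarrow> ((nat \<Rightarrow> real) \<Rightarrow> real \<times> real \<times> real \<times> real) \<Rightarrow> bool" where
  "polynomial_matrix V F \<longleftrightarrow> (\<exists>a b c d. pvars a \<union> pvars b \<union> pvars c \<union> pvars d \<subseteq> V \<and>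
     (\<forall>x. F x = (peval a x, peval b x, peval c x, peval d x)))"

lemma polynomial_matrix_one: "polynomial_matrix V (\<lambda>x. \<one>\<^bsub>SL2\<^esub>)"
  unfolding polynomial_matrix_def
  by (intro exI[of _ "PConst 1"] exI[of _ "PConst 0"]) auto

lemma polynomial_matrix_mult:
  assumes "polynomial_matrix V F" "polynomial_matrix V F'"
  shows "polynomial_matrix V (\<lambda>x. F x \<otimes>\<^bsub>SL2\<^esub> F' x)"
proof -
  obtain a b c d where
    "pvars a \<union> pvars b \<union> pvars c \<union> pvars d \<subseteq> V" "\<forall>x. F x = (peval a x, peval b x, peval c x, peval d x)"
    using assms(1) unfolding polynomial_matrix_def by blast
  moreover obtain a' b' c' d' where
    "pvars a' \<union> pvars b' \<union> pvars c' \<union> pvars d' \<subseteq> V" "\<forall>x. F' x = (peval a' x, peval b' x, peval c' x, peval d' x)"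
    using assms(2) unfolding polynomial_matrix_def by blast
  ultimately show ?thesis
    unfolding polynomial_matrix_def
    by - (rule exI[of _ "PAdd (PMul a a') (PMul b c')"], rule exI[of _ "PAdd (PMul a b') (PMul b d')"],
        rule exI[of _ "PAdd (PMul c a') (PMul d c')"], rule exI[of _ "PAdd (PMul c b') (PMul d d')"], simp)
qed

text \<open>With determinant one the inverse is the adjugate, so no denominators appear.\<close>

lemma polynomial_matrix_inv:
  assumes "polynomial_matrix V F" "\<And>x. F x \<in> carrier SL2"
  shows "polynomial_matrix V (\<lambda>x. inv\<^bsub>SL2\<^esub> (F x))"
proof -
  obtain a b c d where
    F: "pvars a \<union> pvars b \<union> pvars c \<union> pvars d \<subseteq> V" "\<forall>x. F x = (peval a x, peval b x, peval c x, peval d x)"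
    using assms(1) unfolding polynomial_matrix_def by blast
  then have "peval a x * peval d x - peval b x * peval c x = 1" for x
    using assms(2)[of x] by (simp add: SL2_carrier)
  then show ?thesis
    unfolding polynomial_matrix_def using F
    by (intro exI[of _ d] exI[of _ "PMul (PConst (-1)) b"] exI[of _ "PMul (PConst (-1)) c"] exI[of _ a])
      (auto simp: SL2_inv)
qed

lemma polynomial_matrix_param:
  assumes "{4 * i, 4 * i + 1, 4 * i + 2, 4 * i + 3} \<subseteq> V"
  shows "polynomial_matrix V (\<lambda>x. SL2_param (\<lambda>k. x (4 * i + k)))"
proof -
  let ?p = "PVar (4 * i)" and ?q = "PVar (4 * i + 1)" and ?r = "PVar (4 * i + 2)" and ?s = "PVar (4 * i + 3)"
  let ?pq = "PAdd (PConst 1) (PMul ?p ?q)" and ?rs = "PAdd (PConst 1) (PMul ?r ?s)"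
  show ?thesis
    unfolding polynomial_matrix_def using assms
    by (intro exI[of _ "PAdd (PMul ?pq ?rs) (PMul ?p ?s)"] exI[of _ "PAdd (PMul ?pq ?r) ?p"]
        exI[of _ "PAdd (PMul ?q ?rs) ?s"] exI[of _ "PAdd (PMul ?q ?r) (PConst 1)"])
      (auto simp: SL2_param_def)
qed

lemma polynomial_matrix_entry:
  assumes "polynomial_matrix V F" "k < 4"
  obtains f where "pvars f \<subseteq> V" "\<forall>x. entry k (F x) = peval f x"
proof -
  obtain a b c d where
    F: "pvars a \<union> pvars b \<union> pvars c \<union> pvars d \<subseteq> V" "\<forall>x. F x = (peval a x, peval b x, peval c x, peval d x)"
    using assms(1) unfolding polynomial_matrix_def by blast
  have "k = 0 \<or> k = 1 \<or> k = 2 \<or> k = 3" using assms(2) by auto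
  then have "pvars ([a, b, c, d] ! k) \<subseteq> V" "\<forall>x. entry k (F x) = peval ([a, b, c, d] ! k) x"
    using F by (auto simp: entry_def numeral_2_eq_2 numeral_3_eq_3)
  then show thesis by (rule that)
qed

text \<open>The bound \<open>n\<close> may exceed the rank, so that subgroups of different ranks can
  share the same 4n parameters.\<close>

locale indexed_basis = group G for G :: "('a, 'b) monoid_scheme" (structure) +
  fixes B :: "'a set" and idx :: "'a \<Rightarrow> nat" and n :: nat
  assumes basis: "free_family G B" and idx_inj: "inj_on idx B" and idx_less: "idx ` B \<subseteq> {..<n}"
begin

definition rep :: "(nat \<Rightarrow> real) \<Rightarrow> 'a \<Rightarrow> real \<times> real \<times> real \<times> real" where
  "rep x = lift_map G B SL2 (\<lambda>b. SL2_param (\<lambda>k. x (4 * idx b + k)))"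

lemma free_lift_SL2: "f ` B \<subseteq> carrier SL2 \<Longrightarrow> free_lift G SL2 B f"
  using basis group_SL2 by (auto simp: free_lift_def free_lift_axioms_def group_axioms)

lemma free_lift_rep: "free_lift G SL2 B (\<lambda>b. SL2_param (\<lambda>k. x (4 * idx b + k)))"
  using SL2_param_carrier by (intro free_lift_SL2) auto

lemma polynomial_matrix_rep:
  assumes "g \<in> generate G B"
  shows "polynomial_matrix {..<4 * n} (\<lambda>x. rep x g)"
proof -
  have BG: "B \<subseteq> carrier G" using basis by (auto simp: free_family_def)
  obtain w where "word_reduced w" and w: "snd ` set w \<subseteq> B" "word_eval G w = g"
    by (rule generate_word[OF BG assms])
  have "rep x g = word_eval SL2 (map (apsnd (\<lambda>b. SL2_param (\<lambda>k. x (4 * idx b + k)))) w)" for x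
    using free_lift.lift_word_eval[OF free_lift_rep w(1), of x] w(2) by (simp add: rep_def)
  moreover have "polynomial_matrix {..<4 * n}
      (\<lambda>x. word_eval SL2 (map (apsnd (\<lambda>b. SL2_param (\<lambda>k. x (4 * idx b + k)))) w))"
    using w(1)
  proof (induction w)
    case Nil
    show ?case using polynomial_matrix_one by simp
  next
    case (Cons l w)
    have "idx (snd l) < n" using Cons.prems idx_less by auto
    then have "polynomial_matrix {..<4 * n} (\<lambda>x. SL2_param (\<lambda>k. x (4 * idx (snd l) + k)))"
      by (intro polynomial_matrix_param) auto
    moreover from polynomial_matrix_inv[OF this SL2_param_carrier]
    have "polynomial_matrix {..<4 * n} (\<lambda>x. inv\<^bsub>SL2\<^esub> (SL2_param (\<lambda>k. x (4 * idx (snd l) + k))))" .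
    ultimately show ?case
      using Cons by (cases "fst l") (auto simp: word_eval_Cons intro!: polynomial_matrix_mult)
  qed
  ultimately show ?thesis by simp
qed

text \<open>Different basis elements use disjoint blocks of four parameters, so their matrices can
  be prescribed independently.\<close>

lemma rep_onto:
  assumes f: "f ` B \<subseteq> carrier SL2"
  obtains x where "\<forall>g\<in>generate G B. rep x g = lift_map G B SL2 f g"
proof -
  have "\<exists>y. SL2_param y = f b" if "b \<in> B" for b
    using SL2_param_surj[of "f b"] f that by (metis image_subset_iff)
  then obtain Y where Y: "\<And>b. b \<in> B \<Longrightarrow> SL2_param (Y b) = f b" by metis
  \<comment> \<open>The quotient by 4 names the basis element and the remainder names the parameter
    within its block.\<close>
  define x where "x = (\<lambda>l. Y (inv_into B idx (l div 4)) (l mod 4))"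
  have "SL2_param (\<lambda>k. x (4 * idx b + k)) = f b" if "b \<in> B" for b
  proof -
    have "SL2_param (\<lambda>k. x (4 * idx b + k)) = SL2_param (Y b)"
      using inv_into_f_f[OF idx_inj that] by (simp add: SL2_param_def x_def)
    then show ?thesis using Y that by simp
  qed
  then have eq: "map (apsnd (\<lambda>b. SL2_param (\<lambda>k. x (4 * idx b + k)))) w = map (apsnd f) w"
    if "snd ` set w \<subseteq> B" for w using that by (auto simp: image_subset_iff)
  have BG: "B \<subseteq> carrier G" using basis by (auto simp: free_family_def)
  have "rep x g = lift_map G B SL2 f g" if g: "g \<in> generate G B" for g
  proof -
    obtain w where "word_reduced w" and w: "snd ` set w \<subseteq> B" "word_eval G w = g"
      by (rule generate_word[OF BG g])
    show ?thesis
      using free_lift.lift_word_eval[OF free_lift_rep w(1), of x]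
        free_lift.lift_word_eval[OF free_lift_SL2[OF f] w(1)] w(2) eq[OF w(1)] by (simp add: rep_def)
  qed
  then show thesis using that by blast
qed

text \<open>After substitution, a relation between matrix entries becomes a rational polynomial in
  the 4n parameters. Vanishing at a generic point, it vanishes identically.\<close>

lemma rep_specialize:
  assumes t: "generic (4 * n) t" and \<sigma>: "\<And>i. i \<in> pvars p \<Longrightarrow> \<sigma> i \<in> generate G B \<times> {..<4}"
    and 0: "peval p (\<lambda>i. entry (snd (\<sigma> i)) (rep t (fst (\<sigma> i)))) = 0"
  shows "peval p (\<lambda>i. entry (snd (\<sigma> i)) (rep x (fst (\<sigma> i)))) = 0"
proof -
  have "\<exists>f. pvars f \<subseteq> {..<4 * n} \<and> (\<forall>x. entry (snd (\<sigma> i)) (rep x (fst (\<sigma> i))) = peval f x)"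
    if "i \<in> pvars p" for i
    using polynomial_matrix_entry[OF polynomial_matrix_rep, of "fst (\<sigma> i)" "snd (\<sigma> i)"] \<sigma>[OF that]
    by (metis lessThan_iff mem_Times_iff)
  then obtain f where f: "\<And>i. i \<in> pvars p \<Longrightarrow> pvars (f i) \<subseteq> {..<4 * n}"
    "\<And>i x. i \<in> pvars p \<Longrightarrow> entry (snd (\<sigma> i)) (rep x (fst (\<sigma> i))) = peval (f i) x" by metis
  have ev: "peval (psubst f p) x = peval p (\<lambda>i. entry (snd (\<sigma> i)) (rep x (fst (\<sigma> i))))" for x
    unfolding peval_psubst using f(2) by (intro peval_cong) simp
  have "pvars (psubst f p) \<subseteq> {..<4 * n}" using f(1) by (auto simp: pvars_psubst)
  then have "\<not> nonzero (psubst f p)" using t ev[of t] 0 by (auto simp: generic_def)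
  then show ?thesis using ev[of x] by (simp add: nonzero_def)
qed

text \<open>If the generic representation killed a nontrivial element, all representations in SL2
  over the reals would kill it by specialization, but one of them separates it from the
  identity.\<close>

lemma rep_inj:
  assumes t: "generic (4 * n) t" and g: "g \<in> generate G B" and h: "h \<in> generate G B"
    and eq: "rep t g = rep t h"
  shows "g = h"
proof (rule ccontr)
  assume "g \<noteq> h"
  have BG: "B \<subseteq> carrier G" using basis by (auto simp: free_family_def)
  have gh: "g \<in> carrier G" "h \<in> carrier G" using g h generate_in_carrier[OF BG] by blast+
  define u where "u = g \<otimes> inv h"
  have hi: "inv h \<in> generate G B" using generate_m_inv_closed[OF BG h] .
  then have u: "u \<in> generate G B" unfolding u_def using g by (intro generate.eng)
  have "u \<noteq> \<one>"
    using \<open>g \<noteq> h\<close> gh inv_equality[of g "inv h"] by (auto simp: u_def)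
  obtain w where w: "word_reduced w" "snd ` set w \<subseteq> B" "word_eval G w = u"
    by (rule generate_word[OF BG u])
  have "w \<noteq> []" using w \<open>u \<noteq> \<one>\<close> by auto
  then obtain f :: "'a \<Rightarrow> real \<times> real \<times> real \<times> real"
    where f: "range f \<subseteq> carrier SL2" "word_eval SL2 (map (apsnd f) w) \<noteq> \<one>\<^bsub>SL2\<^esub>"
    using SL2_real_separates[OF w(1)] by blast
  have fB: "f ` B \<subseteq> carrier SL2" using f(1) by auto
  obtain x where x: "\<forall>g\<in>generate G B. rep x g = lift_map G B SL2 f g" by (rule rep_onto[OF fB])
  interpret T: free_lift G SL2 B "\<lambda>b. SL2_param (\<lambda>k. t (4 * idx b + k))" by (rule free_lift_rep)
  have "rep t u = \<one>\<^bsub>SL2\<^esub>"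
    using eq T.lift_mult[OF g hi] T.lift_inv[OF h] T.lift_closed[OF h]
    by (simp add: rep_def u_def del: SL2_one)
  have "entry k (rep x u) = entry k \<one>\<^bsub>SL2\<^esub>" if "k < 4" for k
  proof -
    \<comment> \<open>Agreement with an entry of the identity must be phrased as the vanishing of an
      expression, which requires that entry to be a rational constant.\<close>
    have "\<exists>c. entry k \<one>\<^bsub>SL2\<^esub> = of_rat c"
    proof -
      have "k = 0 \<or> k = 1 \<or> k = 2 \<or> k = 3" using that by auto
      then show ?thesis
        by (auto simp: entry_def numeral_2_eq_2 numeral_3_eq_3 intro: exI[of _ 0] exI[of _ 1])
    qed
    then obtain c where c: "entry k \<one>\<^bsub>SL2\<^esub> = of_rat c" by blast
    have "peval (PAdd (PVar 0) (PConst (- c))) (\<lambda>i. entry (snd (u, k)) (rep x (fst (u, k)))) = 0"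
    proof (rule rep_specialize[OF t, where \<sigma> = "\<lambda>_. (u, k)"])
      show "peval (PAdd (PVar 0) (PConst (- c))) (\<lambda>i. entry (snd (u, k)) (rep t (fst (u, k)))) = 0"
        by (simp only: peval.simps fst_conv snd_conv \<open>rep t u = \<one>\<^bsub>SL2\<^esub>\<close> c of_rat_minus)
    qed (use u that in auto)
    then show ?thesis using c by (simp add: of_rat_minus)
  qed
  then have "rep x u = \<one>\<^bsub>SL2\<^esub>" by (rule eq_by_entries)
  then have "lift_map G B SL2 f u = \<one>\<^bsub>SL2\<^esub>" using x u by simp
  then show False
    using free_lift.lift_word_eval[OF free_lift_SL2[OF fB] w(2)] w(3) f(2) by simp
qed

end

lemma countable_dependents:
  assumes G: "locally_free G" and Z: "free_family G Z" "finite Z"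
  shows "countable (dependents G Z)"
proof -
  interpret group G using G by (simp add: locally_free_def)
  let ?K = "dependents G Z" and ?n = "card Z"
  have "\<exists>B idx. indexed_basis G B idx ?n \<and> generate G B = generate G (Z \<union> T)"
    if T: "finite T" "T \<subseteq> ?K" for T
  proof -
    obtain B where B: "free_family G B" "finite B" "card B \<le> ?n" "generate G B = generate G (Z \<union> T)"
      using dependents_rank_le[OF G Z T] by blast
    obtain idx where "idx ` B = {0..<card B}" "inj_on idx B"
      using ex_bij_betw_finite_nat[OF B(2)] by (auto simp: bij_betw_def)
    then have "indexed_basis G B idx ?n"
      using B by unfold_locales auto
    then show ?thesis using B(4) by blast
  qed
  then obtain B idx where IB: "\<And>T. finite T \<Longrightarrow> T \<subseteq> ?K \<Longrightarrow> indexed_basis G (B T) (idx T) ?n"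
    and gen: "\<And>T. finite T \<Longrightarrow> T \<subseteq> ?K \<Longrightarrow> generate G (B T) = generate G (Z \<union> T)" by metis
  obtain t where t: "generic (4 * ?n) t" using generic_exists by blast
  \<comment> \<open>The point \<open>t\<close> is the same at every stage; only the chosen basis
    changes.\<close>
  define \<rho> where "\<rho> = (\<lambda>T. indexed_basis.rep G (B T) (idx T))"
  have TB: "T \<subseteq> generate G (B T)" if "finite T" "T \<subseteq> ?K" for T
    using gen[OF that] by (auto intro: generate.incl)
  show ?thesis
  proof (rule countable_if_transcendence_bounded[where N = "4 * ?n" and
        val = "\<lambda>T s. entry (snd s) (\<rho> T t (fst s))"])
    fix S S' p and \<sigma> :: "nat \<Rightarrow> 'a \<times> nat"
    assume S': "finite S'" "S \<subseteq> S'" "S' \<subseteq> ?K"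
      and \<sigma>: "\<And>i. i \<in> pvars p \<Longrightarrow> \<sigma> i \<in> S \<times> {..<4}"
      and 0: "peval p (\<lambda>i. entry (snd (\<sigma> i)) (\<rho> S t (fst (\<sigma> i)))) = 0"
    have S: "finite S" "S \<subseteq> ?K" using S' finite_subset by auto
    interpret B: indexed_basis G "B S" "idx S" ?n using IB[OF S] .
    interpret B': indexed_basis G "B S'" "idx S'" ?n using IB[OF S'(1,3)] .
    interpret L: free_lift G SL2 "B S'" "\<lambda>b. SL2_param (\<lambda>k. t (4 * idx S' b + k))"
      by (rule B'.free_lift_rep)
    have "generate G (B S) \<subseteq> generate G (B S')"
      unfolding gen[OF S] gen[OF S'(1,3)] using S' by (intro mono_generate) auto
    then have BB: "B S \<subseteq> generate G (B S')" by (auto intro: generate.incl)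
    have f: "B'.rep t ` B S \<subseteq> carrier SL2" using BB L.lift_closed by (auto simp: B'.rep_def)
    \<comment> \<open>The generic representation of the larger subgroup, restricted to the smaller
      one, is determined by its values on the old basis. It is therefore the old representation at
      some parameter point \<open>x\<close>, to which relations holding at \<open>t\<close>
      specialize.\<close>
    then obtain x where x: "\<forall>g\<in>generate G (B S). B.rep x g = lift_map G (B S) SL2 (B'.rep t) g"
      by (rule B.rep_onto)
    have eq: "B.rep x g = B'.rep t g" if g: "g \<in> generate G (B S)" for g
    proof -
      have "B S \<subseteq> carrier G" using B.basis by (simp add: free_family_def)
      then obtain w where "word_reduced w" and w: "snd ` set w \<subseteq> B S" "word_eval G w = g"
        by (rule generate_word[OF _ g])
      have "B.rep x g = word_eval SL2 (map (apsnd (B'.rep t)) w)"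
        using free_lift.lift_word_eval[OF B.free_lift_SL2[OF f] w(1)] w(2) x g by simp
      also have "\<dots> = B'.rep t g"
        using L.lift_word_eval_generate[of w] w BB by (simp add: B'.rep_def)
      finally show ?thesis .
    qed
    have \<sigma>B: "\<sigma> i \<in> generate G (B S) \<times> {..<4}" if "i \<in> pvars p" for i
      using \<sigma>[OF that] TB[OF S] by (auto simp: mem_Times_iff)
    have "peval p (\<lambda>i. entry (snd (\<sigma> i)) (B'.rep t (fst (\<sigma> i)))) =
        peval p (\<lambda>i. entry (snd (\<sigma> i)) (B.rep x (fst (\<sigma> i))))"
      using eq \<sigma>B by (intro peval_cong) (simp add: mem_Times_iff)
    also have "\<dots> = 0"
      by (rule B.rep_specialize[OF t, where \<sigma> = \<sigma>, OF \<sigma>B 0[unfolded \<rho>_def]])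
    finally show "peval p (\<lambda>i. entry (snd (\<sigma> i)) (\<rho> S' t (fst (\<sigma> i)))) = 0"
      by (simp add: \<rho>_def)
  next
    fix S and \<sigma> :: "nat \<Rightarrow> 'a \<times> nat"
    assume S: "finite S" "S \<subseteq> ?K" and \<sigma>: "\<And>i. i \<le> 4 * ?n \<Longrightarrow> \<sigma> i \<in> S \<times> {..<4}"
    interpret B: indexed_basis G "B S" "idx S" ?n using IB[OF S] .
    \<comment> \<open>Any 4n + 1 matrix entries are polynomials in the 4n parameters, hence
      algebraically dependent.\<close>
    have "\<exists>f. pvars f \<subseteq> {..<4 * ?n} \<and> entry (snd (\<sigma> i)) (\<rho> S t (fst (\<sigma> i))) = peval f t"
      if "i \<le> 4 * ?n" for i
    proof -
      have "fst (\<sigma> i) \<in> generate G (B S)" "snd (\<sigma> i) < 4"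
        using \<sigma>[OF that] TB[OF S] by (auto simp: mem_Times_iff)
      then show ?thesis
        using polynomial_matrix_entry[OF B.polynomial_matrix_rep] unfolding \<rho>_def by metis
    qed
    then obtain f where f: "\<And>i. i \<le> 4 * ?n \<Longrightarrow> pvars (f i) \<subseteq> {..<4 * ?n}"
      "\<And>i. i \<le> 4 * ?n \<Longrightarrow> entry (snd (\<sigma> i)) (\<rho> S t (fst (\<sigma> i))) = peval (f i) t" by metis
    obtain p where p: "pvars p \<subseteq> {..4 * ?n}" "nonzero p" "peval p (\<lambda>j. peval (f j) t) = 0"
      by (rule algebraic_dependence[OF f(1)])
    have "peval p (\<lambda>i. entry (snd (\<sigma> i)) (\<rho> S t (fst (\<sigma> i)))) = peval p (\<lambda>j. peval (f j) t)"
      using p(1) f(2) by (intro peval_cong) auto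
    with p show "\<exists>p. pvars p \<subseteq> {..4 * ?n} \<and> nonzero p \<and>
        peval p (\<lambda>i. entry (snd (\<sigma> i)) (\<rho> S t (fst (\<sigma> i)))) = 0" by auto
  next
    fix S g h
    assume S: "finite S" "S \<subseteq> ?K" "g \<in> S" "h \<in> S"
      and eq: "\<And>k. k < 4 \<Longrightarrow> entry (snd (g, k)) (\<rho> S t (fst (g, k))) = entry (snd (h, k)) (\<rho> S t (fst (h, k)))"
    interpret B: indexed_basis G "B S" "idx S" ?n using IB[OF S(1,2)] .
    have "B.rep t g = B.rep t h" using eq by (intro eq_by_entries) (simp add: \<rho>_def)
    then show "g = h" using TB[OF S(1,2)] S(3,4) by (intro B.rep_inj[OF t]) auto
  qed
qed

section \<open>Maximal free families\<close>

lemma lepoll_iff_ordLeq: "lepoll A B \<longleftrightarrow> |A| \<le>o |B|"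
  unfolding lepoll_def card_of_ordLeq ..

text \<open>Inserting a point maps pairs of a point and an n-element subset onto the subsets with n
  + 1 elements. Each size class is thus bounded by the square of \<open>M\<close>, and countably
  many classes are united.\<close>

lemma infinite_finite_subsets_lepoll:
  assumes "infinite M"
  shows "lepoll {Y. Y \<subseteq> M \<and> finite Y} M"
proof -
  have n: "|{Y. Y \<subseteq> M \<and> finite Y \<and> card Y = n}| \<le>o |M|" for n
  proof (induction n)
    case 0
    have "{Y. Y \<subseteq> M \<and> finite Y \<and> card Y = 0} = {{}}" by auto
    moreover have "finite {{} :: 'a set}" by simp
    ultimately show ?case using assms
      by (metis card_of_ordLeq_infinite card_of_ordLeq_finite ordLeq_total card_of_Well_order)
  next
    case (Suc n)
    let ?F = "\<lambda>n. {Y. Y \<subseteq> M \<and> finite Y \<and> card Y = n}"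
    have "?F (Suc n) \<subseteq> (\<lambda>(x, Y). insert x Y) ` (M \<times> ?F n)"
    proof
      fix Y assume Y: "Y \<in> ?F (Suc n)"
      then obtain x Z where "Y = insert x Z" "x \<notin> Z" "card Z = n" by (auto simp: card_Suc_eq)
      then show "Y \<in> (\<lambda>(x, Y). insert x Y) ` (M \<times> ?F n)"
        using Y by (auto intro!: image_eqI[of _ _ "(x, Z)"])
    qed
    then have "|?F (Suc n)| \<le>o |M \<times> ?F n|"
      unfolding lepoll_iff_ordLeq[symmetric] by (rule subset_image_lepoll)
    also have "|M \<times> ?F n| \<le>o |M|"
      using card_of_Times_ordLeq_infinite[OF assms card_of_refl[THEN ordIso_imp_ordLeq] Suc] .
    finally show ?case .
  qed
  have "|UNIV :: nat set| \<le>o |M|" using assms infinite_iff_card_of_nat by blast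
  then have "|\<Union>n. {Y. Y \<subseteq> M \<and> finite Y \<and> card Y = n}| \<le>o |M|"
    using n assms by (intro card_of_UNION_ordLeq_infinite) auto
  moreover have "(\<Union>n. {Y. Y \<subseteq> M \<and> finite Y \<and> card Y = n}) = {Y. Y \<subseteq> M \<and> finite Y}" by auto
  ultimately show ?thesis by (simp add: lepoll_iff_ordLeq)
qed

lemma countable_UN_lepoll:
  assumes "infinite M" "lepoll I M" "\<And>i. i \<in> I \<Longrightarrow> countable (A i)"
  shows "lepoll (\<Union>i\<in>I. A i) M"
proof -
  have N: "|UNIV :: nat set| \<le>o |M|" using assms infinite_iff_card_of_nat by blast
  have "|A i| \<le>o |M|" if "i \<in> I" for i
  proof -
    have "|A i| \<le>o |UNIV :: nat set|"
      using assms(3)[OF that] by (auto simp: countable_def simp flip: card_of_ordLeq)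
    then show ?thesis using N ordLeq_transitive by blast
  qed
  moreover have "|I| \<le>o |M|" using assms(2) by (simp add: lepoll_iff_ordLeq)
  ultimately have "|\<Union>i\<in>I. A i| \<le>o |M|"
    using assms(1) by (intro card_of_UNION_ordLeq_infinite) auto
  then show ?thesis by (simp add: lepoll_iff_ordLeq)
qed

text \<open>Freeness has finite character: a relation involves finitely many letters, so in the
  union of a chain it already occurs in one member.\<close>

lemma maximal_free_family:
  assumes Z: "free_family G Z"
  obtains M where "Z \<subseteq> M" "free_family G M" "\<forall>g. free_family G (insert g M) \<longrightarrow> g \<in> M"
proof -
  let ?A = "{M. Z \<subseteq> M \<and> free_family G M}"
  have "\<exists>M\<in>?A. \<forall>U\<in>?A. M \<subseteq> U \<longrightarrow> U = M"
  proof (rule subset_Zorn_nonempty)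
    show "?A \<noteq> {}" using Z by auto
    fix C assume C: "C \<noteq> {}" "subset.chain ?A C"
    then have CA: "C \<subseteq> ?A" by (auto simp: subset.chain_def)
    have "word_eval G w \<noteq> \<one>\<^bsub>G\<^esub>" if w: "w \<noteq> []" "word_reduced w" "snd ` set w \<subseteq> \<Union>C" for w
    proof -
      obtain D where "D \<in> C" "snd ` set w \<subseteq> D"
        using finite_subset_Union_chain[OF _ w(3) C] by auto
      then show ?thesis using CA w by (auto simp: free_family_def)
    qed
    moreover have "\<Union>C \<subseteq> carrier G" using CA by (auto simp: free_family_def)
    moreover have "Z \<subseteq> \<Union>C" using CA C(1) by blast
    ultimately show "\<Union>C \<in> ?A" by (simp add: free_family_def)
  qed
  then obtain M where M: "Z \<subseteq> M" "free_family G M" "\<forall>U\<in>?A. M \<subseteq> U \<longrightarrow> U = M" by blast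
  have "g \<in> M" if "free_family G (insert g M)" for g
    using M(3)[rule_format, of "insert g M"] that M(1) by auto
  then show thesis using that M by blast
qed

lemma large_free_family:
  assumes G: "locally_free G" "\<not> countable (carrier G)" and Z: "free_family G Z" "finite Z"
  obtains U where "Z \<inter> U = {}" "free_family G (Z \<union> U)" "U \<approx> carrier G"
proof -
  interpret group G using G by (simp add: locally_free_def)
  obtain M where M: "Z \<subseteq> M" "free_family G M" "\<forall>g. free_family G (insert g M) \<longrightarrow> g \<in> M"
    using maximal_free_family[OF Z(1)] .
  let ?F = "{Y. Y \<subseteq> M \<and> finite Y}"
  \<comment> \<open>By maximality, an element outside \<open>M\<close> satisfies a relation with
    elements of \<open>M\<close>; the finitely many letters from \<open>M\<close> in that relation
    form the set on which it depends. An element of \<open>M\<close> depends on itself.\<close>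
  have "g \<in> (\<Union>Y\<in>?F. dependents G Y)" if g: "g \<in> carrier G" for g
  proof (cases "g \<in> M")
    case True
    then show ?thesis using g by (auto intro!: exI[of _ "{g}"] simp: dependents_def)
  next
    case False
    then have "\<not> free_family G (insert g M)" using M(3) by blast
    then obtain w where w: "w \<noteq> []" "word_reduced w" "snd ` set w \<subseteq> insert g M" "word_eval G w = \<one>\<^bsub>G\<^esub>"
      using g M(2) by (auto simp: free_family_def)
    let ?Y = "snd ` set w \<inter> M"
    have "snd ` set w \<subseteq> insert g ?Y" using w(3) by auto
    then have "\<not> free_family G (insert g ?Y)" using w unfolding free_family_def by blast
    then have "g \<in> dependents G ?Y" using g by (simp add: dependents_def)
    moreover have "?Y \<in> ?F" by simp
    ultimately show ?thesis by blast
  qed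
  then have sub: "carrier G \<subseteq> (\<Union>Y\<in>?F. dependents G Y)" by blast
  have cnt: "countable (dependents G Y)" if "Y \<in> ?F" for Y
    using that free_family_subset[OF M(2)] by (intro countable_dependents[OF G(1)]) auto
  \<comment> \<open>A finite \<open>M\<close> would have finitely many subsets, making the carrier
    countable.\<close>
  have inf: "infinite M"
  proof
    assume "finite M"
    then have "countable ?F" by (intro countable_finite) auto
    then have "countable (\<Union>Y\<in>?F. dependents G Y)" using cnt by (rule countable_UN)
    then show False using sub G(2) countable_subset by blast
  qed
  have "lepoll (carrier G) (\<Union>Y\<in>?F. dependents G Y)" using sub by (rule subset_imp_lepoll)
  also have "lepoll \<dots> M"
    using countable_UN_lepoll[OF inf infinite_finite_subsets_lepoll[OF inf] cnt] .
  finally have GM: "lepoll (carrier G) M" .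
  have "M \<subseteq> carrier G" using M(2) by (simp add: free_family_def)
  have "infinite (M - Z)" using inf Z(2) by simp
  \<comment> \<open>The elements of \<open>Z\<close> are put back one at a time; inserting one
    element into an infinite set does not change its cardinality.\<close>
  have "M - Z \<union> Y \<approx> M - Z" if "finite Y" for Y
    using that
  proof (induction Y rule: finite_induct)
    case (insert y Y)
    then have "insert y (M - Z \<union> Y) \<approx> M - Z \<union> Y"
      using \<open>infinite (M - Z)\<close> by (intro infinite_insert_eqpoll) simp
    then show ?case using insert.IH eqpoll_trans by auto
  qed simp
  from this[OF Z(2)] have "M \<approx> M - Z" using M(1) by (simp add: Un_absorb2)
  then have "lepoll (carrier G) (M - Z)" using GM lepoll_trans2 by blast
  moreover have "lepoll (M - Z) (carrier G)" using \<open>M \<subseteq> carrier G\<close> by (intro subset_imp_lepoll) auto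
  ultimately have "M - Z \<approx> carrier G" by (intro lepoll_antisym)
  moreover have "Z \<union> (M - Z) = M" using M(1) by auto
  ultimately show thesis using M(2) by (intro that[of "M - Z"]) auto
qed

section \<open>Free products\<close>

definition fp_val :: "'a + 'a \<Rightarrow> 'a" where
  "fp_val l = (case l of Inl a \<Rightarrow> a | Inr b \<Rightarrow> b)"

definition fp_eval :: "('a, 'b) monoid_scheme \<Rightarrow> ('a + 'a) list \<Rightarrow> 'a" where
  "fp_eval G w = foldr (\<lambda>l r. fp_val l \<otimes>\<^bsub>G\<^esub> r) w \<one>\<^bsub>G\<^esub>"

lemma fp_eval_Nil [simp]: "fp_eval G [] = \<one>\<^bsub>G\<^esub>"
  and fp_eval_Cons [simp]: "fp_eval G (l # w) = fp_val l \<otimes>\<^bsub>G\<^esub> fp_eval G w"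
  by (simp_all add: fp_eval_def)

lemma fp_val_simps [simp]: "fp_val (Inl a) = a" "fp_val (Inr a) = a"
  by (simp_all add: fp_val_def)

lemma fp_reduced_Cons:
  "fp_reduced G1 G2 (l # w) \<longleftrightarrow>
     (case l of Inl a \<Rightarrow> a \<in> carrier G1 \<and> a \<noteq> \<one>\<^bsub>G1\<^esub> | Inr b \<Rightarrow> b \<in> carrier G2 \<and> b \<noteq> \<one>\<^bsub>G2\<^esub>) \<and>
     fp_reduced G1 G2 w \<and> (w = [] \<or> isl (hd w) \<noteq> isl l)"
  by (cases l; cases w) (auto split: sum.splits)

lemma fp_reduced_fp_cons:
  assumes "group G1" "group G2" "fp_reduced G1 G2 w"
    "case l of Inl a \<Rightarrow> a \<in> carrier G1 | Inr b \<Rightarrow> b \<in> carrier G2"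
  shows "fp_reduced G1 G2 (fp_cons G1 G2 l w)"
proof -
  interpret G1: group G1 by fact
  interpret G2: group G2 by fact
  show ?thesis
    using assms(3,4) by (cases "(G1, G2, l, w)" rule: fp_cons.cases) (auto simp: fp_reduced_Cons)
qed

locale internal_free_product = group G for G :: "('a, 'b) monoid_scheme" (structure) +
  fixes U Y :: "'a set"
  assumes free_XY: "free_family G (U \<union> Y)" and disj: "U \<inter> Y = {}"
begin

abbreviation "A \<equiv> generate G U"
abbreviation "H \<equiv> generate G Y"
abbreviation "GA \<equiv> subgroup_generated G A"
abbreviation "GH \<equiv> subgroup_generated G H"
abbreviation "red \<equiv> fp_reduced GA GH"

definition side :: "'a + 'a \<Rightarrow> 'a set" where
  "side l = (if isl l then U else Y)"

text \<open>A reduced spelling of one syllable in the generators of its own factor. Uniqueness of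
  free product normal forms is deduced from uniqueness of reduced words over
  \<open>U \<union> Y\<close> by spelling out the syllables.\<close>

definition rword :: "'a + 'a \<Rightarrow> (bool \<times> 'a) list" where
  "rword l = (SOME w. word_reduced w \<and> snd ` set w \<subseteq> side l \<and> word_eval G w = fp_val l)"

lemma XY: "U \<subseteq> carrier G" "Y \<subseteq> carrier G"
  using free_XY by (auto simp: free_family_def)

lemma carriers: "carrier GA = A" "carrier GH = H" "A \<subseteq> carrier G" "H \<subseteq> carrier G"
  using subgroup.carrier_subgroup_generated_subgroup[OF generate_is_subgroup[OF XY(1)]]
    subgroup.carrier_subgroup_generated_subgroup[OF generate_is_subgroup[OF XY(2)]]
    generate_in_carrier[OF XY(1)] generate_in_carrier[OF XY(2)] by auto

lemma red_Cons: "red (l # w) \<longleftrightarrow>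
    fp_val l \<in> generate G (side l) \<and> fp_val l \<noteq> \<one> \<and> red w \<and> (w = [] \<or> isl (hd w) \<noteq> isl l)"
  by (cases l) (auto simp: fp_reduced_Cons carriers side_def)

lemma side_cases: "isl l \<noteq> isl k \<Longrightarrow> side l \<inter> side k = {}"
  using disj by (auto simp: side_def)

lemma rword:
  assumes "fp_val l \<in> generate G (side l)"
  shows "word_reduced (rword l)" "snd ` set (rword l) \<subseteq> side l" "word_eval G (rword l) = fp_val l"
proof -
  have "side l \<subseteq> carrier G" using XY by (auto simp: side_def)
  then obtain w where "word_reduced w" "snd ` set w \<subseteq> side l" "word_eval G w = fp_val l"
    using assms by (rule generate_word)
  then have "\<exists>w. word_reduced w \<and> snd ` set w \<subseteq> side l \<and> word_eval G w = fp_val l" by blast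
  from someI_ex[OF this] show "word_reduced (rword l)" "snd ` set (rword l) \<subseteq> side l"
    "word_eval G (rword l) = fp_val l"
    unfolding rword_def by auto
qed

text \<open>Consecutive syllables come from different factors, so their spellings use disjoint
  alphabets and nothing cancels where they meet. The clause about the first letter carries this
  through the induction.\<close>

lemma red_rwords:
  assumes "red w"
  shows "word_reduced (concat (map rword w)) \<and> snd ` set (concat (map rword w)) \<subseteq> U \<union> Y \<and>
    word_eval G (concat (map rword w)) = fp_eval G w \<and>
    (w \<noteq> [] \<longrightarrow> concat (map rword w) \<noteq> [] \<and> snd (hd (concat (map rword w))) \<in> side (hd w))"
  using assms
proof (induction w)
  case (Cons l w)
  have l: "fp_val l \<in> generate G (side l)" "fp_val l \<noteq> \<one>" "red w" "w = [] \<or> isl (hd w) \<noteq> isl l"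
    using Cons.prems by (auto simp: red_Cons)
  note r = rword[OF l(1)]
  have IH: "word_reduced (concat (map rword w))" "snd ` set (concat (map rword w)) \<subseteq> U \<union> Y"
    "word_eval G (concat (map rword w)) = fp_eval G w"
    "w \<noteq> [] \<Longrightarrow> concat (map rword w) \<noteq> []" "w \<noteq> [] \<Longrightarrow> snd (hd (concat (map rword w))) \<in> side (hd w)"
    using Cons.IH[OF l(3)] by blast+
  have ne: "rword l \<noteq> []" using r(3) l(2) by auto
  have "snd (last (rword l)) \<in> side l" "snd (hd (rword l)) \<in> side l"
    using r(2) last_in_set[OF ne] hd_in_set[OF ne] by blast+
  moreover have "snd (last (rword l)) \<noteq> snd (hd (concat (map rword w)))" if "w \<noteq> []"
    using IH(5)[OF that] calculation(1) side_cases[of "hd w" l] l(4) that by auto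
  ultimately have "word_reduced (rword l @ concat (map rword w))"
    using r(1) IH(1) by (cases "w = []") (auto simp: word_reduced_append)
  moreover have sl: "side l \<subseteq> U \<union> Y" by (auto simp: side_def)
  moreover have "word_eval G (rword l @ concat (map rword w)) = fp_val l \<otimes> fp_eval G w"
    using r(3) IH(3) order.trans[OF r(2) sl] IH(2) XY
    by (subst word_eval_append) (blast, blast, simp)
  ultimately show ?case
    using r(2) IH(2) ne \<open>snd (hd (rword l)) \<in> side l\<close> by (auto simp: image_Un)
qed auto

text \<open>The first syllable can be read back from the concatenation: its spelling is the longest
  prefix over the alphabet of its factor.\<close>

lemma rwords_inj:
  assumes "red u" "red v" "concat (map rword u) = concat (map rword v)"
  shows "u = v"
  using assms
proof (induction u arbitrary: v)
  case Nil
  then show ?case using red_rwords[of v] by (cases v) auto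
next
  case (Cons l u)
  have "concat (map rword (l # u)) \<noteq> []" using red_rwords[OF Cons.prems(1)] by blast
  then obtain k w where v: "v = k # w" using Cons.prems(3) by (cases v) auto
  have h: "snd (hd (concat (map rword (l # u)))) \<in> side l" "snd (hd (concat (map rword (k # w)))) \<in> side k"
    using red_rwords[OF Cons.prems(1)] red_rwords[OF Cons.prems(2)] v by auto
  then have lk: "isl l = isl k" using Cons.prems(3) v side_cases[of l k] by auto
  then have side: "side k = side l" by (simp add: side_def)
  have tw: "takeWhile (\<lambda>x. snd x \<in> side m) (concat (map rword (m # z))) = rword m"
    if "red (m # z)" for m z
  proof -
    have m: "fp_val m \<in> generate G (side m)" "red z" "z = [] \<or> isl (hd z) \<noteq> isl m"
      using that by (auto simp: red_Cons)
    have "takeWhile (\<lambda>x. snd x \<in> side m) (concat (map rword z)) = []"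
    proof (cases "z = []")
      case False
      then have "snd (hd (concat (map rword z))) \<notin> side m"
        using red_rwords[OF m(2)] m(3) side_cases[of "hd z" m] by auto
      moreover have "concat (map rword z) \<noteq> []" using red_rwords[OF m(2)] False by blast
      ultimately show ?thesis by (cases "concat (map rword z)") (simp_all del: concat_eq_Nil_conv)
    qed simp
    moreover have "\<forall>x\<in>set (rword m). snd x \<in> side m" using rword(2)[OF m(1)] by auto
    ultimately show ?thesis by (simp add: takeWhile_append2)
  qed
  have "rword l = rword k"
    using tw[OF Cons.prems(1)] tw[of k w] Cons.prems(2,3) v side by simp
  moreover have "fp_val l \<in> generate G (side l)" "fp_val k \<in> generate G (side k)"
    using Cons.prems v by (auto simp: red_Cons)
  ultimately have "fp_val l = fp_val k" using rword(3) by metis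
  then have "l = k" using lk by (cases l; cases k) auto
  moreover have "u = w"
    using Cons.prems v \<open>rword l = rword k\<close> by (intro Cons.IH) (auto simp: red_Cons)
  ultimately show ?case using v by simp
qed

lemma fp_eval_inj: "inj_on (fp_eval G) {w. red w}"
proof (rule inj_onI)
  fix u v assume "u \<in> {w. red w}" "v \<in> {w. red w}" "fp_eval G u = fp_eval G v"
  then show "u = v"
    using red_rwords[of u] red_rwords[of v]
    by (intro rwords_inj reduced_word_unique[OF free_XY]) auto
qed

lemma red_vals: "red w \<Longrightarrow> fp_val ` set w \<subseteq> A \<union> H"
  by (induction w) (auto simp: red_Cons side_def split: if_splits)

lemma fp_eval_closed: "red w \<Longrightarrow> fp_eval G w \<in> carrier G"
  using red_rwords[of w] XY word_eval_closed[of "concat (map rword w)"] by (metis Un_least subset_trans)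

lemma fp_eval_fp_cons:
  assumes "red w" "case l of Inl a \<Rightarrow> a \<in> carrier GA | Inr b \<Rightarrow> b \<in> carrier GH"
  shows "fp_eval G (fp_cons GA GH l w) = fp_val l \<otimes> fp_eval G w"
proof -
  have l: "fp_val l \<in> carrier G" using assms(2) carriers by (cases l) auto
  show ?thesis
  proof (cases w)
    case Nil
    then show ?thesis using l by (cases l) auto
  next
    case (Cons k v)
    have "red v" using assms(1) Cons by (simp add: red_Cons)
    then have "fp_eval G v \<in> carrier G" by (rule fp_eval_closed)
    moreover have "fp_val k \<in> carrier G"
      using assms(1) Cons carriers by (cases k) (auto simp: fp_reduced_Cons)
    ultimately show ?thesis
      using Cons l by (cases l; cases k) (auto simp: m_assoc[symmetric])
  qed
qed

text \<open>Reducedness and the value of the product are proved together, because evaluating one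
  more multiplication step presupposes that the product so far is reduced.\<close>

lemma fp_mult:
  assumes "red u" "red v"
  shows "red (u \<otimes>\<^bsub>free_product GA GH\<^esub> v) \<and>
    fp_eval G (u \<otimes>\<^bsub>free_product GA GH\<^esub> v) = fp_eval G u \<otimes> fp_eval G v"
  using assms
proof (induction u)
  case Nil
  then show ?case by (auto simp: free_product_def fp_eval_closed)
next
  case (Cons l u)
  have l: "case l of Inl a \<Rightarrow> a \<in> carrier GA | Inr b \<Rightarrow> b \<in> carrier GH" and u: "red u"
    using Cons.prems(1) by (auto simp: fp_reduced_Cons split: sum.splits)
  let ?uv = "u \<otimes>\<^bsub>free_product GA GH\<^esub> v"
  have IH: "red ?uv" "fp_eval G ?uv = fp_eval G u \<otimes> fp_eval G v" using Cons.IH u Cons.prems by auto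
  have eq: "(l # u) \<otimes>\<^bsub>free_product GA GH\<^esub> v = fp_cons GA GH l ?uv" by (simp add: free_product_def)
  have "fp_val l \<in> carrier G" using l carriers by (cases l) auto
  then show ?case
    unfolding eq using IH l u Cons.prems fp_eval_closed
    by (simp add: fp_reduced_fp_cons fp_eval_fp_cons m_assoc)
qed

lemma fp_eval_image: "fp_eval G ` {w. red w} = generate G (A \<union> H)"
proof
  show "fp_eval G ` {w. red w} \<subseteq> generate G (A \<union> H)"
  proof clarify
    fix w assume "red w"
    then have "fp_val ` set w \<subseteq> A \<union> H" by (rule red_vals)
    then show "fp_eval G w \<in> generate G (A \<union> H)"
      by (induction w) (auto intro: generate.intros)
  qed
  have one: "\<one> \<in> fp_eval G ` {w. red w}" by (rule image_eqI[of _ _ "[]"]) auto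
  have incl: "h \<in> fp_eval G ` {w. red w}" if "h \<in> A \<union> H" for h
  proof (cases "h = \<one>")
    case True
    then show ?thesis using one by simp
  next
    case False
    have "h = fp_eval G [Inl h]" "h = fp_eval G [Inr h]" using that carriers by auto
    moreover have "red [Inl h] \<or> red [Inr h]" using that False carriers by auto
    ultimately show ?thesis by blast
  qed
  show "generate G (A \<union> H) \<subseteq> fp_eval G ` {w. red w}"
  proof
    fix g assume "g \<in> generate G (A \<union> H)"
    then show "g \<in> fp_eval G ` {w. red w}"
    proof (induction rule: generate.induct)
      case (inv h)
      then have "inv h \<in> A \<union> H" using generate_m_inv_closed XY by blast
      then show ?case by (rule incl)
    next
      case (eng h1 h2)
      then obtain u v where "red u" "h1 = fp_eval G u" "red v" "h2 = fp_eval G v" by auto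
      then show ?case
        using fp_mult[of u v] by (auto intro!: image_eqI[of _ _ "u \<otimes>\<^bsub>free_product GA GH\<^esub> v"])
    qed (use one incl in auto)
  qed
qed

lemma free_product_iso: "subgroup_generated G (A \<union> H) \<cong> free_product GA GH"
proof -
  let ?S = "subgroup_generated G (A \<union> H)" and ?F = "free_product GA GH"
  have cF: "carrier ?F = {w. red w}" by (simp add: free_product_def)
  have "carrier G \<inter> (A \<union> H) = A \<union> H" using carriers by blast
  then have cS: "carrier ?S = generate G (A \<union> H)" by (simp add: carrier_subgroup_generated)
  have bij: "bij_betw (fp_eval G) (carrier ?F) (carrier ?S)"
    unfolding cF cS bij_betw_def using fp_eval_inj fp_eval_image by blast
  \<comment> \<open>Evaluation goes from the free product to the subgroup; the isomorphism asked for
    is its inverse, which is multiplicative because evaluation is multiplicative and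
    injective.\<close>
  let ?h = "inv_into (carrier ?F) (fp_eval G)"
  have bij': "bij_betw ?h (carrier ?S) (carrier ?F)" using bij by (rule bij_betw_inv_into)
  have "?h \<in> hom ?S ?F"
  proof (rule homI)
    show "?h x \<in> carrier ?F" if "x \<in> carrier ?S" for x
      using bij' that by (auto dest: bij_betwE)
    fix x y assume xy: "x \<in> carrier ?S" "y \<in> carrier ?S"
    have h: "?h x \<in> carrier ?F" "?h y \<in> carrier ?F"
      using bij' xy by (auto dest: bij_betwE)
    have "fp_eval G (?h x) = x" "fp_eval G (?h y) = y"
      using bij xy by (auto intro: bij_betw_inv_into_right)
    then have "fp_eval G (?h x \<otimes>\<^bsub>?F\<^esub> ?h y) = x \<otimes> y" and F: "?h x \<otimes>\<^bsub>?F\<^esub> ?h y \<in> carrier ?F"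
      using fp_mult[of "?h x" "?h y"] h unfolding cF by auto
    then have "?h (x \<otimes> y) = ?h x \<otimes>\<^bsub>?F\<^esub> ?h y"
      using bij_betw_inv_into_left[OF bij F] by simp
    then show "?h (x \<otimes>\<^bsub>?S\<^esub> y) = ?h x \<otimes>\<^bsub>?F\<^esub> ?h y" by simp
  qed
  then show ?thesis using bij' unfolding is_iso_def iso_def by blast
qed

end

theorem theorem1p1:
  fixes G :: "('a, 'b) monoid_scheme"
  assumes "locally_free G"
    and "\<not> countable (carrier G)"
  shows "(\<forall>A. fin_gen_subgroup G A \<longrightarrow>
            (\<exists>H. subgroup H G \<and> H \<approx> carrier G \<and>
                 subgroup_generated G (A \<union> H) \<cong>
                   free_product (subgroup_generated G A) (subgroup_generated G H)))
       \<and> (\<exists>F. subgroup F G \<and> F \<approx> carrier G \<and> free_group (subgroup_generated G F))"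
proof -
  interpret group G using assms(1) by (simp add: locally_free_def)
  \<comment> \<open>The generated subgroup is squeezed between \<open>U\<close> and the carrier,
    which have equal cardinality.\<close>
  have large: "subgroup (generate G U) G \<and> generate G U \<approx> carrier G"
    if "U \<subseteq> carrier G" "U \<approx> carrier G" for U
  proof -
    have sub: "subgroup (generate G U) G" using that(1) by (rule generate_is_subgroup)
    have "U \<subseteq> generate G U" by (auto intro: generate.incl)
    then have "lepoll (carrier G) (generate G U)"
      using that(2) by (meson eqpoll_sym lepoll_trans1 subset_imp_lepoll)
    moreover have "lepoll (generate G U) (carrier G)"
      using subgroup.subset[OF sub] by (rule subset_imp_lepoll)
    ultimately show ?thesis using sub lepoll_antisym by blast
  qed
  show ?thesis
  proof (intro conjI allI impI)
    fix A assume "fin_gen_subgroup G A"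
    then obtain S where S: "finite S" "S \<subseteq> carrier G" "generate G S = A"
      by (auto simp: fin_gen_subgroup_def)
    obtain Z where Z: "free_family G Z" "finite Z" "generate G Z = generate G S"
      using locally_free_basis[OF assms(1) S(1,2)] .
    obtain U where U: "Z \<inter> U = {}" "free_family G (Z \<union> U)" "U \<approx> carrier G"
      using large_free_family[OF assms Z(1,2)] .
    \<comment> \<open>The subgroup generated by \<open>Z\<close> is \<open>A\<close>, and the one
      generated by \<open>U\<close> serves as \<open>H\<close>.\<close>
    interpret internal_free_product G Z U by unfold_locales (use U in auto)
    show "\<exists>H. subgroup H G \<and> H \<approx> carrier G \<and> subgroup_generated G (A \<union> H) \<cong>
        free_product (subgroup_generated G A) (subgroup_generated G H)"
      using free_product_iso large[OF XY(2) U(3)] Z(3) S(3) by auto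
  next
    \<comment> \<open>The free subgroup is obtained by starting the maximal free family from the
      empty set, that is, from a basis of the trivial subgroup.\<close>
    have "free_family G {}" by (auto simp: free_family_def)
    then obtain U where U: "free_family G ({} \<union> U)" "U \<approx> carrier G"
      using large_free_family[OF assms, of "{}"] by blast
    then have XG: "U \<subseteq> carrier G" by (simp add: free_family_def)
    have "carrier G \<inter> generate G U = generate G U" using generate_in_carrier[OF XG] by blast
    moreover have "generate G (generate G U) = generate G U"
      using generate_subset_iff[of "generate G U" U] generate_in_carrier[OF XG] XG
      by (auto intro: generate.incl)
    ultimately have "free_basis (subgroup_generated G (generate G U)) U"
      using U(1) by (simp add: free_basis_subgroup_generated_iff)
    then have "free_group (subgroup_generated G (generate G U))"
      by (auto simp: free_group_def)
    then show "\<exists>F. subgroup F G \<and> F \<approx> carrier G \<and> free_group (subgroup_generated G F)"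
      using large[OF XG U(2)] by blast
  qed
qed

end
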